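(* For $n\ge 2$ let $\mathcal{O}_n$ be the set of all outerplanar maps with $n$ vertices and, for $M\in\mathcal{O}_n$, let $\mathcal{B}(M)$ be the set of bipolar orientations of $M$ (with fixed source and sink). Then $$\max_{M\in\mathcal{O}_n}|\mathcal{B}(M)|=F_{n-1}\approx 1.618^{\,n-1},$$ where $F_m$ is the $m$th Fibonacci number, and $\approx$ refers to the exponential growth rate, $\lim_{n\to\infty}F_{n-1}^{1/(n-1)}=\frac{1+\sqrt5}{2}\approx1.618$.
   Context: Fibonacci numbers: $F_1=F_2=1$ and $F_m=F_{m-1}+F_{m-2}$ for $m\ge3$. A planar map is a finite simple planar graph with a fixed crossing-free embedding in the plane; it is outerplanar if all vertices lie on the outer face. Each map $M$ is considered together with two fixed distinct vertices $s$ and $t$ on its outer face (not necessarily adjacent). A bipolar orientation of (connected) $M$ with source $s$ and sink $t$ is an acyclic orientation of the edges of $M$ in which $s$ is the only vertex without incoming edges and $t$ is the only vertex without outgoing edges. The maximum is over all outerplanar maps with $n$ vertices and all choices of $s,t$. *)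

theory Defs
  imports "HOL-Analysis.Analysis" "HOL-Number_Theory.Fib"
begin

text \<open>The vertices of a map are points of the plane (identified with the complex numbers), an edge
  is the two-element set of its endpoints, so that the graph is simple, and \<open>curve M e\<close> is the arc
  that draws the edge \<open>e\<close>. The values of \<open>curve M\<close> outside \<open>edges M\<close> are irrelevant.\<close>

record plane_map =
  verts :: "complex set"
  edges :: "complex set set"
  curve :: "complex set \<Rightarrow> real \<Rightarrow> complex"

definition planar_map :: "plane_map \<Rightarrow> bool" where
  "planar_map M \<longleftrightarrow>
     finite (verts M) \<and>
     (\<forall>e\<in>edges M. e \<subseteq> verts M \<and> card e = 2) \<and>
     (\<forall>e\<in>edges M. arc (curve M e) \<and>
        {pathstart (curve M e), pathfinish (curve M e)} = e \<and>
        path_image (curve M e) \<inter> verts M = e) \<and>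
     (\<forall>e\<in>edges M. \<forall>f\<in>edges M. e \<noteq> f \<longrightarrow>
        path_image (curve M e) \<inter> path_image (curve M f) = e \<inter> f)"

definition drawing :: "plane_map \<Rightarrow> complex set" where
  "drawing M = verts M \<union> (\<Union>e\<in>edges M. path_image (curve M e))"

text \<open>The drawing is compact, so its complement has exactly one unbounded component, and
  \<^const>\<open>outside\<close> is that component.\<close>

definition outer_face :: "plane_map \<Rightarrow> complex set" where
  "outer_face M = outside (drawing M)"

definition on_outer_face :: "plane_map \<Rightarrow> complex \<Rightarrow> bool" where
  "on_outer_face M v \<longleftrightarrow> v \<in> verts M \<and> v \<in> frontier (outer_face M)"

definition outerplanar_map :: "plane_map \<Rightarrow> bool" where
  "outerplanar_map M \<longleftrightarrow> planar_map M \<and> (\<forall>v\<in>verts M. on_outer_face M v)"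

definition outerplanar_maps :: "nat \<Rightarrow> plane_map set" where
  "outerplanar_maps n = {M. outerplanar_map M \<and> card (verts M) = n}"

text \<open>An orientation is the set of its directed edges, a pair \<open>(u, v)\<close> being directed from
  \<open>u\<close> to \<open>v\<close>.\<close>

definition orientation :: "plane_map \<Rightarrow> (complex \<times> complex) set \<Rightarrow> bool" where
  "orientation M D \<longleftrightarrow>
     (\<forall>(u, v)\<in>D. {u, v} \<in> edges M) \<and>
     (\<forall>u v. {u, v} \<in> edges M \<longrightarrow> ((u, v) \<in> D \<longleftrightarrow> (v, u) \<notin> D))"

text \<open>Connectedness of the map is not demanded: every component of an acyclically oriented finite
  graph has a vertex without incoming edges, so a disconnected map has no bipolar orientation.\<close>

definition bipolar_orientation ::
  "plane_map \<Rightarrow> complex \<Rightarrow> complex \<Rightarrow> (complex \<times> complex) set \<Rightarrow> bool" where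
  "bipolar_orientation M s t D \<longleftrightarrow>
     orientation M D \<and> acyclic D \<and>
     {v \<in> verts M. \<nexists>u. (u, v) \<in> D} = {s} \<and>
     {v \<in> verts M. \<nexists>w. (v, w) \<in> D} = {t}"

definition bipolar_orientations ::
  "plane_map \<Rightarrow> complex \<Rightarrow> complex \<Rightarrow> (complex \<times> complex) set set" where
  "bipolar_orientations M s t = {D. bipolar_orientation M s t D}"

definition bipolar_counts :: "nat \<Rightarrow> nat set" where
  "bipolar_counts n =
     {card (bipolar_orientations M s t) | M s t.
        M \<in> outerplanar_maps n \<and> on_outer_face M s \<and> on_outer_face M t \<and> s \<noteq> t}"

end

theory Submission
  imports Defs
begin

text \<open>
  \<^emph>\<open>Upper bound.\<close> The proof is an induction on the number of vertices. The basic operation suppresses a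
  vertex of degree at most 2: the vertex is deleted and its neighbours are joined by an edge, which
  can be drawn along the two old edges, so the map stays outerplanar (\<open>suppress_outerplanar\<close>). At a
  vertex other than \<open>s\<close> and \<open>t\<close> this keeps every bipolar orientation recognisable
  (\<open>card_bipolar_suppress_inner\<close>). Suppressing the source \<open>s\<close> hands its role to one of its at most two
  neighbours (\<open>card_bipolar_suppress_source\<close>). If \<open>s\<close> has to be suppressed because no vertex other
  than \<open>s\<close> and \<open>t\<close> is available, one of these neighbours has degree at most 2 afterwards and can be suppressed as well when the
  other one is the source, which gives the Fibonacci recursion (\<open>card_bipolar_le_fib\<close>).

  The induction needs a vertex of degree at most 2 other than a given one
  (\<open>low_degree_vertex\<close>). A depth-first search in a graph without such a vertex produces a
  \<open>K\<^sub>4\<close> minor or a \<open>K\<^sub>2\<^sub>,\<^sub>3\<close> minor. Both patterns have maximum degree 3, so a minor yields a subdivision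
  drawn with arcs (\<open>cubic_minor_drawn\<close>). These drawings are impossible for a topological reason: a vertex on the
  outer face is never enclosed by a cycle, but among three arcs with common endpoints one must run
  inside the cycle formed by the other two (\<open>theta_chord_inside\<close>, a consequence of Janiszewski's theorem and
  the Jordan curve theorem).

  \<^emph>\<open>Lower bound.\<close> Triangulate a strip by a zigzag path, the vertices being numbered along the path, and take the first
  vertex as the source and the last as the sink. Direct all edges towards larger numbers, except that any set of
  edges of the zigzag path other than the first and the last one may be reversed, as long as no two of
  them are consecutive. There are \<open>F\<^sub>n\<^sub>-\<^sub>1\<close> such sets.
\<close>


section \<open>Three arcs with common endpoints\<close>

definition arc_between :: "'a::topological_space \<Rightarrow> 'a \<Rightarrow> (real \<Rightarrow> 'a) \<Rightarrow> bool" where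
  "arc_between a b c \<longleftrightarrow> arc c \<and> pathstart c = a \<and> pathfinish c = b"

lemma arc_between_rev: "arc_between a b c \<Longrightarrow> arc_between b a (reversepath c)"
  by (simp add: arc_between_def arc_reversepath)

lemma arc_between_join:
  assumes "arc_between a b c" "arc_between b d c'" "path_image c \<inter> path_image c' \<subseteq> {b}"
  shows "arc_between a d (c +++ c')" "path_image (c +++ c') = path_image c \<union> path_image c'"
  using assms by (auto simp: arc_between_def arc_join path_image_join)

lemma arc_between_ends:
  assumes "arc_between a b c"
  shows "a \<in> path_image c" "b \<in> path_image c" "a \<noteq> b"
  using assms arc_distinct_ends[of c]
  by (auto simp: arc_between_def pathstart_in_path_image pathfinish_in_path_image)

lemma infinite_arc_between:
  fixes a b :: "'a::metric_space"
  assumes "arc_between a b c"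
  shows "infinite (path_image c)"
  using arc_between_ends[OF assms] assms connected_finite_iff_sing[of "path_image c"]
  by (auto simp: arc_between_def connected_arc_image)

definition theta :: "complex \<Rightarrow> complex \<Rightarrow> (real \<Rightarrow> complex) \<Rightarrow> (real \<Rightarrow> complex) \<Rightarrow> (real \<Rightarrow> complex) \<Rightarrow> bool" where
  "theta a b c1 c2 c3 \<longleftrightarrow>
     arc_between a b c1 \<and> arc_between a b c2 \<and> arc_between a b c3 \<and>
     path_image c1 \<inter> path_image c2 \<subseteq> {a, b} \<and>
     path_image c1 \<inter> path_image c3 \<subseteq> {a, b} \<and>
     path_image c2 \<inter> path_image c3 \<subseteq> {a, b}"

lemma theta_perm:
  assumes "theta a b c1 c2 c3"
  shows "theta a b c2 c1 c3" "theta a b c1 c3 c2"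
  using assms by (auto simp: theta_def)

lemma theta_cycle:
  assumes "theta a b c1 c2 c3"
  shows "inside (path_image c1 \<union> path_image c2) \<noteq> {}"
    and "connected (inside (path_image c1 \<union> path_image c2))"
    and "frontier (inside (path_image c1 \<union> path_image c2)) = path_image c1 \<union> path_image c2"
    and "closed (path_image c1 \<union> path_image c2)"
proof -
  let ?c = "c1 +++ reversepath c2"
  have arcs: "arc c1" "arc c2" "pathstart c1 = a" "pathstart c2 = a" "pathfinish c1 = b"
    "pathfinish c2 = b" "path_image c1 \<inter> path_image c2 \<subseteq> {a, b}"
    using assms by (auto simp: theta_def arc_between_def)
  have img: "path_image ?c = path_image c1 \<union> path_image c2"
    using arcs by (simp add: path_image_join)
  have "simple_path ?c" "pathfinish ?c = pathstart ?c"
    using arcs by (auto intro!: simple_path_join_loop simp: arc_reversepath)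
  from Jordan_inside_outside[OF this] show "inside (path_image c1 \<union> path_image c2) \<noteq> {}"
    and "connected (inside (path_image c1 \<union> path_image c2))"
    and "frontier (inside (path_image c1 \<union> path_image c2)) = path_image c1 \<union> path_image c2"
    by (simp_all add: img)
  show "closed (path_image c1 \<union> path_image c2)"
    using arcs by (simp add: closed_arc_image closed_Un)
qed

lemma connected_subset_inside:
  assumes "connected A" "A \<inter> C = {}" "x \<in> A" "x \<in> inside C"
  shows "A \<subseteq> inside C"
proof
  fix y assume "y \<in> A"
  then have "connected_component (- C) x y"
    using assms by (auto simp: connected_component_def)
  with \<open>x \<in> inside C\<close> show "y \<in> inside C"
    by (metis inside_same_component)
qed

lemma connected_component_outside:
  fixes S :: "complex set"
  assumes "bounded S" "a \<in> outside S" "b \<in> outside S"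
  shows "connected_component (- S) a b"
proof -
  have "connected (outside S)" "outside S \<subseteq> - S"
    using assms(1) outside_no_overlap[of S] by (auto intro!: connected_outside simp del: outside_no_overlap)
  with assms show ?thesis
    unfolding connected_component_def by blast
qed

text \<open>A point that can escape to infinity avoiding \<open>C1 \<union> C3\<close>, and also avoiding
  \<open>C2 \<union> C3\<close>, can escape avoiding all three sets: this is Janiszewski's theorem, because the two
  obstacles meet in the connected set \<open>C3\<close>.\<close>

lemma inside_Un_subset:
  fixes C1 C2 C3 :: "complex set"
  assumes "compact C1" "compact C2" "compact C3" "connected C3" "C1 \<inter> C2 \<subseteq> C3"
  shows "inside (C1 \<union> C2) \<subseteq> inside (C1 \<union> C3) \<union> inside (C2 \<union> C3) \<union> C3"
proof (rule ccontr)
  assume "\<not> ?thesis"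
  then obtain a where a: "a \<in> inside (C1 \<union> C2)" "a \<notin> inside (C1 \<union> C3)" "a \<notin> inside (C2 \<union> C3)" "a \<notin> C3"
    by blast
  then have "a \<notin> C1" "a \<notin> C2"
    using inside_no_overlap[of "C1 \<union> C2"] by blast+
  with a have out: "a \<in> outside (C1 \<union> C3)" "a \<in> outside (C2 \<union> C3)"
    using inside_Un_outside[of "C1 \<union> C3"] inside_Un_outside[of "C2 \<union> C3"] by blast+
  have bd: "bounded (C1 \<union> C2 \<union> C3)"
    using assms by (simp add: compact_imp_bounded)
  then obtain b where b: "b \<in> outside (C1 \<union> C2 \<union> C3)"
    using outside_bounded_nonempty by blast
  then have b': "b \<in> outside (C1 \<union> C3)" "b \<in> outside (C2 \<union> C3)" "b \<in> outside (C1 \<union> C2)"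
    using outside_mono[of "C1 \<union> C3" "C1 \<union> C2 \<union> C3"] outside_mono[of "C2 \<union> C3" "C1 \<union> C2 \<union> C3"]
      outside_mono[of "C1 \<union> C2" "C1 \<union> C2 \<union> C3"] by blast+
  have eq: "(C1 \<union> C3) \<inter> (C2 \<union> C3) = C3"
    using assms by blast
  have "connected_component (- ((C1 \<union> C3) \<union> (C2 \<union> C3))) a b"
  proof (rule Janiszewski)
    show "compact (C1 \<union> C3)" "closed (C2 \<union> C3)" "connected ((C1 \<union> C3) \<inter> (C2 \<union> C3))"
      using assms by (auto simp: eq compact_imp_closed)
    show "connected_component (- (C1 \<union> C3)) a b" "connected_component (- (C2 \<union> C3)) a b"
      using bd out b' by (simp_all only: bounded_Un connected_component_outside)
  qed
  then have "connected_component (- (C1 \<union> C2)) b a"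
    by (meson Compl_anti_mono connected_component_of_subset connected_component_sym sup.mono sup_ge1)
  with b' have "a \<in> outside (C1 \<union> C2)"
    using outside_same_component by blast
  with a show False
    using inside_Int_outside[of "C1 \<union> C2"] by blast
qed

text \<open>A cycle whose inside is avoided by the third arc bounds a face of the theta curve. Two such
  faces are disjoint or equal, and equality is impossible because the frontier of each is the
  cycle around it.\<close>

lemma theta_insides_differ:
  assumes th: "theta a b c1 c2 c3"
    and z: "z \<in> inside (path_image c1 \<union> path_image c2)" "z \<in> inside (path_image c1 \<union> path_image c3)"
    and d3: "inside (path_image c1 \<union> path_image c2) \<inter> path_image c3 = {}"
    and d2: "inside (path_image c1 \<union> path_image c3) \<inter> path_image c2 = {}"
  shows False
proof -
  let ?A = "inside (path_image c1 \<union> path_image c2)"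
  let ?B = "inside (path_image c1 \<union> path_image c3)"
  note th' = theta_perm(2)[OF th]
  have "?A \<subseteq> ?B"
    using connected_subset_inside[OF theta_cycle(2)[OF th], of "path_image c1 \<union> path_image c3" z]
      d3 z inside_no_overlap[of "path_image c1 \<union> path_image c2"] by blast
  moreover have "?B \<subseteq> ?A"
    using connected_subset_inside[OF theta_cycle(2)[OF th'], of "path_image c1 \<union> path_image c2" z]
      d2 z inside_no_overlap[of "path_image c1 \<union> path_image c3"] by blast
  ultimately have "?A = ?B" by blast
  then have "path_image c1 \<union> path_image c2 = path_image c1 \<union> path_image c3"
    using theta_cycle(3)[OF th] theta_cycle(3)[OF th'] by metis
  then have "path_image c3 \<subseteq> {a, b}"
    using th by (auto simp: theta_def)
  moreover have "infinite (path_image c3)"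
    using th by (auto simp: theta_def dest: infinite_arc_between)
  ultimately show False
    by (meson finite.emptyI finite_insert finite_subset)
qed

text \<open>If \<open>c3\<close> ran outside the cycle \<open>c1 \<union> c2\<close>, then, in view of the points \<open>q1\<close> and \<open>q2\<close>, none
  of the three arcs would enter the inside of the cycle formed by the other two. All three insides
  would be faces of the theta curve, whereas each point of the first one lies in one of the
  others by Janiszewski's theorem.\<close>

lemma theta_chord_inside:
  assumes th: "theta a b c1 c2 c3"
    and q1: "q1 \<in> path_image c1" "q1 \<notin> {a, b}" "q1 \<notin> inside (path_image c2 \<union> path_image c3)"
    and q2: "q2 \<in> path_image c2" "q2 \<notin> {a, b}" "q2 \<notin> inside (path_image c1 \<union> path_image c3)"
  shows "path_image c3 - {a, b} \<subseteq> inside (path_image c1 \<union> path_image c2)"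
proof (rule ccontr)
  assume *: "\<not> ?thesis"
  have open_arc: "connected (path_image c - {a, b})" if "arc_between a b c" for c
    using that connected_simple_path_endless[of c] by (auto simp: arc_between_def arc_imp_simple_path)
  \<comment> \<open>An open arc that misses a cycle lies on one side of it, so a single point decides.\<close>
  have not_in: "path_image c \<inter> inside (path_image d \<union> path_image e) = {}"
    if "theta a b d e c" "q \<in> path_image c - {a, b}" "q \<notin> inside (path_image d \<union> path_image e)"
    for c d e q
  proof (rule ccontr)
    assume "path_image c \<inter> inside (path_image d \<union> path_image e) \<noteq> {}"
    then obtain p where p: "p \<in> path_image c" "p \<in> inside (path_image d \<union> path_image e)" by blast
    have "{a, b} \<subseteq> path_image d"
      using that arc_between_ends[of a b d] by (auto simp: theta_def)
    with p have "p \<notin> {a, b}"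
      using inside_no_overlap[of "path_image d \<union> path_image e"] by blast
    then have "path_image c - {a, b} \<subseteq> inside (path_image d \<union> path_image e)"
      using that p by (intro connected_subset_inside[of _ _ p] open_arc) (auto simp: theta_def)
    with that show False by blast
  qed
  let ?I12 = "inside (path_image c1 \<union> path_image c2)"
  have d12: "path_image c3 \<inter> ?I12 = {}"
    using * not_in[OF th] by blast
  have d13: "path_image c2 \<inter> inside (path_image c1 \<union> path_image c3) = {}"
    using not_in[OF theta_perm(2)[OF th], of q2] q2 by blast
  have th23: "theta a b c2 c3 c1"
    using th by (auto simp: theta_def)
  have d23: "path_image c1 \<inter> inside (path_image c2 \<union> path_image c3) = {}"
    using not_in[OF th23, of q1] q1 by blast
  obtain z where z: "z \<in> ?I12"
    using theta_cycle(1)[OF th] by blast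
  have cpt: "compact (path_image c1)" "compact (path_image c2)" "compact (path_image c3)"
      "connected (path_image c3)" "path_image c1 \<inter> path_image c2 \<subseteq> path_image c3"
    using th arc_between_ends[of a b c3]
    by (auto simp: theta_def arc_between_def compact_arc_image connected_arc_image)
  from inside_Un_subset[OF this] z d12
  consider "z \<in> inside (path_image c1 \<union> path_image c3)" | "z \<in> inside (path_image c2 \<union> path_image c3)"
    by blast
  then show False
  proof cases
    case 1
    then show False using theta_insides_differ[OF th z 1] d12 d13 by blast
  next
    case 2
    have th': "theta a b c2 c1 c3" using theta_perm(1)[OF th] .
    show False
      using theta_insides_differ[OF th', of z] z 2 d12 d23 by (simp add: Un_commute Int_commute)
  qed
qed

text \<open>The last assumption says that no cycle encloses one of the four corners. By the previous
  lemma, both chords run inside the cycle that the four arcs form. The chord \<open>f\<close> then lies in one of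
  the two parts into which \<open>e\<close> cuts the disc, although its endpoints are on different sides of \<open>e\<close>.\<close>

lemma no_crossing_chords:
  fixes x y u v :: complex
  assumes arcs: "arc_between x u p1" "arc_between u y p2" "arc_between x v p3" "arc_between v y p4"
      "arc_between x y e" "arc_between u v f"
    and int: "path_image p1 \<inter> path_image p2 \<subseteq> {u}" "path_image p1 \<inter> path_image p3 \<subseteq> {x}"
      "path_image p1 \<inter> path_image p4 \<subseteq> {}" "path_image p2 \<inter> path_image p3 \<subseteq> {}"
      "path_image p2 \<inter> path_image p4 \<subseteq> {y}" "path_image p3 \<inter> path_image p4 \<subseteq> {v}"
    and inte: "path_image e \<inter> path_image p1 \<subseteq> {x}" "path_image e \<inter> path_image p2 \<subseteq> {y}"
      "path_image e \<inter> path_image p3 \<subseteq> {x}" "path_image e \<inter> path_image p4 \<subseteq> {y}"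
    and intf: "path_image f \<inter> path_image p1 \<subseteq> {u}" "path_image f \<inter> path_image p2 \<subseteq> {u}"
      "path_image f \<inter> path_image p3 \<subseteq> {v}" "path_image f \<inter> path_image p4 \<subseteq> {v}"
      "path_image e \<inter> path_image f \<subseteq> {}"
    and outer: "\<And>C q. C \<subseteq> path_image p1 \<union> path_image p2 \<union> path_image p3 \<union> path_image p4 \<union> path_image e \<union> path_image f
       \<Longrightarrow> closed C \<Longrightarrow> q \<in> {x, y, u, v} \<Longrightarrow> q \<notin> inside C"
  shows False
proof -
  note ends = arc_between_ends[OF arcs(1)] arc_between_ends[OF arcs(2)] arc_between_ends[OF arcs(3)]
    arc_between_ends[OF arcs(4)] arc_between_ends[OF arcs(5)] arc_between_ends[OF arcs(6)]
  have cl: "closed (path_image p1)" "closed (path_image p2)" "closed (path_image p3)"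
    "closed (path_image p4)" "closed (path_image e)" "closed (path_image f)"
    using arcs by (simp_all add: arc_between_def closed_arc_image)
  note int' = int[THEN subsetD, OF IntI] and inte' = inte[THEN subsetD, OF IntI]
    and intf' = intf[THEN subsetD, OF IntI]
  define c1 c2 where "c1 = p1 +++ p2" and "c2 = p3 +++ p4"
  have c: "arc_between x y c1" "path_image c1 = path_image p1 \<union> path_image p2"
    "arc_between x y c2" "path_image c2 = path_image p3 \<union> path_image p4"
    unfolding c1_def c2_def
    using arc_between_join[OF arcs(1,2) int(1)] arc_between_join[OF arcs(3,4) int(6)] by simp_all
  define d1 d2 where "d1 = reversepath p1 +++ p3" and "d2 = p2 +++ reversepath p4"
  have d: "arc_between u v d1" "path_image d1 = path_image p1 \<union> path_image p3"
    "arc_between u v d2" "path_image d2 = path_image p2 \<union> path_image p4"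
    unfolding d1_def d2_def
    using arc_between_join[OF arc_between_rev[OF arcs(1)] arcs(3)]
      arc_between_join[OF arcs(2) arc_between_rev[OF arcs(4)]] int by (simp_all add: path_image_reversepath)
  have th_e: "theta x y c1 c2 e"
    unfolding theta_def using c(1,3) arcs(5) by (auto simp: c dest: int' inte')
  have th_f: "theta u v d1 d2 f"
    unfolding theta_def using d(1,3) arcs(6) by (auto simp: d dest: int' intf')
  have e: "path_image e - {x, y} \<subseteq> inside (path_image c1 \<union> path_image c2)"
  proof (rule theta_chord_inside[OF th_e])
    show "u \<in> path_image c1" "v \<in> path_image c2" using ends c by auto
    show "u \<notin> {x, y}" "v \<notin> {x, y}" using ends by auto
    show "u \<notin> inside (path_image c2 \<union> path_image e)" "v \<notin> inside (path_image c1 \<union> path_image e)"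
      using cl by (intro outer; auto simp: c)+
  qed
  have f: "path_image f - {u, v} \<subseteq> inside (path_image d1 \<union> path_image d2)"
  proof (rule theta_chord_inside[OF th_f])
    show "x \<in> path_image d1" "y \<in> path_image d2" using ends d by auto
    show "x \<notin> {u, v}" "y \<notin> {u, v}" using ends by auto
    show "x \<notin> inside (path_image d2 \<union> path_image f)" "y \<notin> inside (path_image d1 \<union> path_image f)"
      using cl by (intro outer; auto simp: d)+
  qed
  have "path_image d1 \<union> path_image d2 = path_image c1 \<union> path_image c2"
    by (auto simp: c d)
  with f have f': "path_image f - {u, v} \<subseteq> inside (path_image c1 \<union> path_image c2)" by simp
  have "inside (path_image c1 \<union> path_image c2) \<subseteq>
      inside (path_image c1 \<union> path_image e) \<union> inside (path_image c2 \<union> path_image e) \<union> path_image e"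
    using th_e arc_between_ends[OF arcs(5)]
    by (intro inside_Un_subset) (auto simp: theta_def arc_between_def compact_arc_image connected_arc_image)
  with f' intf(5) have sub: "path_image f - {u, v} \<subseteq>
      inside (path_image c1 \<union> path_image e) \<union> inside (path_image c2 \<union> path_image e)" by blast
  have simple_f: "simple_path f" "pathstart f = u" "pathfinish f = v"
    using arcs by (auto simp: arc_between_def arc_imp_simple_path)
  then have conn: "connected (path_image f - {u, v})"
    using connected_simple_path_endless by metis
  have "infinite (path_image f)"
    using arcs infinite_arc_between by blast
  then obtain z where z: "z \<in> path_image f - {u, v}"
    by (metis Diff_eq_empty_iff finite.emptyI finite_insert finite_subset ex_in_conv)
  \<comment> \<open>The corners are limits of the open chord, so whichever part contains the open chord has both
    \<open>u\<close> and \<open>v\<close> in its closure.\<close>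
  have limpt: "p islimpt (path_image f - {u, v})" if "p \<in> path_image f" for p
  proof -
    have "path_image f \<noteq> {p}"
      using \<open>infinite (path_image f)\<close> by (metis finite.emptyI finite_insert)
    then have "p islimpt path_image f"
      using that simple_f by (intro connected_imp_perfect) (auto simp: connected_simple_path_image)
    moreover have "path_image f = {u, v} \<union> (path_image f - {u, v})"
      using ends by auto
    ultimately have "p islimpt ({u, v} \<union> (path_image f - {u, v}))" by simp
    then show ?thesis
      by (metis finite.emptyI finite_insert islimpt_Un_finite)
  qed
  then have clos: "{u, v} \<subseteq> closure (path_image f - {u, v})"
    using ends by (auto simp: closure_def)
  show False
  proof (cases "z \<in> inside (path_image c1 \<union> path_image e)")
    case True
    have "path_image f - {u, v} \<subseteq> inside (path_image c1 \<union> path_image e)"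
      using conn z True by (intro connected_subset_inside[of _ _ z]) (auto simp: c dest: intf')
    then have "closure (path_image f - {u, v}) \<subseteq> (path_image c1 \<union> path_image e) \<union> inside (path_image c1 \<union> path_image e)"
      using closure_inside_subset closure_mono cl c
      by (metis (no_types, lifting) closed_Un subset_trans)
    with clos have "v \<in> (path_image c1 \<union> path_image e) \<union> inside (path_image c1 \<union> path_image e)" by blast
    moreover have "v \<notin> inside (path_image c1 \<union> path_image e)"
      using cl by (intro outer; auto simp: c)+
    moreover have "v \<notin> path_image c1 \<union> path_image e"
      using ends by (auto simp: c dest: int' intf')
    ultimately show False by blast
  next
    case False
    then have z2: "z \<in> inside (path_image c2 \<union> path_image e)" using z sub by blast
    have "path_image f - {u, v} \<subseteq> inside (path_image c2 \<union> path_image e)"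
      using conn z z2 by (intro connected_subset_inside[of _ _ z]) (auto simp: c dest: intf')
    then have "closure (path_image f - {u, v}) \<subseteq> (path_image c2 \<union> path_image e) \<union> inside (path_image c2 \<union> path_image e)"
      using closure_inside_subset closure_mono cl c
      by (metis (no_types, lifting) closed_Un subset_trans)
    with clos have "u \<in> (path_image c2 \<union> path_image e) \<union> inside (path_image c2 \<union> path_image e)" by blast
    moreover have "u \<notin> inside (path_image c2 \<union> path_image e)"
      using cl by (intro outer; auto simp: c)+
    moreover have "u \<notin> path_image c2 \<union> path_image e"
      using ends by (auto simp: c dest: int' intf')
    ultimately show False by blast
  qed
qed


section \<open>Connected vertex sets\<close>

definition step_in :: "'a set set \<Rightarrow> 'a set \<Rightarrow> ('a \<times> 'a) set" where
  "step_in E K = {(x, y). x \<in> K \<and> y \<in> K \<and> {x, y} \<in> E}"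

definition connected_in :: "'a set set \<Rightarrow> 'a set \<Rightarrow> bool" where
  "connected_in E K \<longleftrightarrow> (\<forall>x\<in>K. \<forall>y\<in>K. (x, y) \<in> (step_in E K)\<^sup>*)"

lemma step_in_mono: "K \<subseteq> K' \<Longrightarrow> step_in E K \<subseteq> step_in E K'"
  by (auto simp: step_in_def)

lemma step_in_rtrancl_mono: "K \<subseteq> K' \<Longrightarrow> (x, y) \<in> (step_in E K)\<^sup>* \<Longrightarrow> (x, y) \<in> (step_in E K')\<^sup>*"
  using rtrancl_mono[OF step_in_mono] by blast

lemma step_in_rtrancl_sym: "(x, y) \<in> (step_in E K)\<^sup>* \<Longrightarrow> (y, x) \<in> (step_in E K)\<^sup>*"
proof -
  have "sym (step_in E K)"
    by (auto simp: sym_def step_in_def insert_commute)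
  then show "(x, y) \<in> (step_in E K)\<^sup>* \<Longrightarrow> (y, x) \<in> (step_in E K)\<^sup>*"
    by (meson sym_rtrancl symE)
qed

lemma step_in_rtrancl_mem: "(x, y) \<in> (step_in E K)\<^sup>* \<Longrightarrow> x \<in> K \<Longrightarrow> y \<in> K"
  by (induction rule: rtrancl_induct) (auto simp: step_in_def)

lemma connected_in_singleton [simp]: "connected_in E {x}"
  by (simp add: connected_in_def)

lemma connected_in_Un:
  assumes "connected_in E A" "connected_in E B" "a \<in> A" "b \<in> B" "a = b \<or> {a, b} \<in> E"
  shows "connected_in E (A \<union> B)"
proof -
  let ?R = "(step_in E (A \<union> B))\<^sup>*"
  have A: "(x, y) \<in> ?R" if "x \<in> A" "y \<in> A" for x y
    using assms(1) that unfolding connected_in_def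
    by (intro step_in_rtrancl_mono[of A "A \<union> B" x y E]) simp_all
  have B: "(x, y) \<in> ?R" if "x \<in> B" "y \<in> B" for x y
    using assms(2) that unfolding connected_in_def
    by (intro step_in_rtrancl_mono[of B "A \<union> B" x y E]) simp_all
  have ab: "(a, b) \<in> ?R"
    using assms(3-5) by (auto simp: step_in_def intro: r_into_rtrancl)
  have AB: "(x, y) \<in> ?R" if "x \<in> A" "y \<in> B" for x y
    using A[OF that(1) assms(3)] ab B[OF assms(4) that(2)] by (meson rtrancl_trans)
  have BA: "(x, y) \<in> ?R" if "x \<in> B" "y \<in> A" for x y
    using step_in_rtrancl_sym[OF AB[OF that(2,1)]] .
  show ?thesis
    unfolding connected_in_def using A B AB BA by (metis UnE)
qed

abbreviation is_walk :: "'a set set \<Rightarrow> 'a list \<Rightarrow> bool" where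
  "is_walk E \<equiv> successively (\<lambda>x y. {x, y} \<in> E)"

lemma connected_in_walk: "is_walk E xs \<Longrightarrow> connected_in E (set xs)"
proof (induction xs rule: induct_list012)
  case (3 x y zs)
  then have "connected_in E ({x} \<union> set (y # zs))"
    by (intro connected_in_Un[of _ _ _ x y]) auto
  then show ?case by (simp add: insert_commute)
qed (auto simp: connected_in_def)

lemma obtain_path:
  assumes "(x, y) \<in> (step_in E K)\<^sup>*" "x \<in> K"
  obtains xs where "xs \<noteq> []" "hd xs = x" "last xs = y" "set xs \<subseteq> K" "distinct xs" "is_walk E xs"
proof -
  have "\<exists>xs. xs \<noteq> [] \<and> hd xs = x \<and> last xs = y \<and> set xs \<subseteq> K \<and> distinct xs \<and> is_walk E xs"
    using assms
  proof (induction rule: converse_rtrancl_induct)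
    case base
    then show ?case by (intro exI[of _ "[y]"]) auto
  next
    case (step x z)
    then have xz: "{x, z} \<in> E" "x \<in> K" "z \<in> K"
      by (auto simp: step_in_def)
    with step obtain xs where xs: "xs \<noteq> []" "hd xs = z" "last xs = y" "set xs \<subseteq> K" "distinct xs" "is_walk E xs"
      by blast
    show ?case
    proof (cases "x \<in> set xs")
      case True
      then obtain us vs where "xs = us @ x # vs" by (meson split_list)
      with xs show ?thesis
        by (intro exI[of _ "x # vs"]) (auto simp: successively_append_iff)
    next
      case False
      with xs xz show ?thesis
        by (intro exI[of _ "x # xs"]) (auto simp: successively_Cons)
    qed
  qed
  with that show thesis by blast
qed

text \<open>The legs come from a path from \<open>a\<close> to \<open>b\<close> and a path from \<open>d\<close> that is stopped at the vertex
  \<open>u\<close> where it first meets the former.\<close>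

lemma obtain_tripod:
  assumes U: "connected_in E U" "a \<in> U" "b \<in> U" "d \<in> U"
  obtains u A B D where "u \<in> A" "u \<in> B" "u \<in> D" "a \<in> A" "b \<in> B" "d \<in> D"
    "A \<subseteq> U" "B \<subseteq> U" "D \<subseteq> U" "connected_in E A" "connected_in E B" "connected_in E D"
    "A \<inter> B \<subseteq> {u}" "A \<inter> D \<subseteq> {u}" "B \<inter> D \<subseteq> {u}"
proof -
  have "(a, b) \<in> (step_in E U)\<^sup>*" "(d, a) \<in> (step_in E U)\<^sup>*"
    using U by (auto simp: connected_in_def)
  then obtain xs ys where
    xs: "xs \<noteq> []" "hd xs = a" "last xs = b" "set xs \<subseteq> U" "distinct xs" "is_walk E xs" and
    ys: "ys \<noteq> []" "hd ys = d" "last ys = a" "set ys \<subseteq> U" "distinct ys" "is_walk E ys"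
    using obtain_path[of a b E U] obtain_path[of d a E U] U by metis
  have "\<exists>z\<in>set ys. z \<in> set xs"
    using xs ys by (metis hd_in_set last_in_set)
  then obtain ds u es where sy: "ys = ds @ u # es" "u \<in> set xs" "\<forall>z\<in>set ds. z \<notin> set xs"
    using split_list_first_prop[of ys "\<lambda>z. z \<in> set xs"] by auto
  then obtain as bs where sx: "xs = as @ u # bs" by (meson split_list)
  show thesis
  proof (rule that[of u "set (as @ [u])" "set (u # bs)" "set (ds @ [u])"])
    show "connected_in E (set (as @ [u]))" "connected_in E (set (u # bs))" "connected_in E (set (ds @ [u]))"
      using xs(6) ys(6) unfolding sx sy
      by (intro connected_in_walk; simp add: successively_append_iff successively_Cons)+
    show "a \<in> set (as @ [u])" "b \<in> set (u # bs)" "d \<in> set (ds @ [u])"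
      using xs(2,3) ys(2) unfolding sx sy(1) by (auto simp: hd_append split: if_splits)
    show "set (as @ [u]) \<subseteq> U" "set (u # bs) \<subseteq> U" "set (ds @ [u]) \<subseteq> U"
      using xs(4) ys(4) by (auto simp: sx sy(1))
    show "set (as @ [u]) \<inter> set (u # bs) \<subseteq> {u}" "set (as @ [u]) \<inter> set (ds @ [u]) \<subseteq> {u}"
       "set (u # bs) \<inter> set (ds @ [u]) \<subseteq> {u}"
      using xs(5) sy(3) unfolding sx by auto
  qed auto
qed

lemma obtain_star:
  assumes U: "connected_in E U" "U \<noteq> {}" and N: "finite N" "card N \<le> 3" "\<And>j. j \<in> N \<Longrightarrow> p j \<in> U"
  obtains u L where "u \<in> U"
    "\<And>j. j \<in> N \<Longrightarrow> L j \<subseteq> U \<and> connected_in E (L j) \<and> u \<in> L j \<and> p j \<in> L j"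
    "\<And>j k. j \<in> N \<Longrightarrow> k \<in> N \<Longrightarrow> j \<noteq> k \<Longrightarrow> L j \<inter> L k \<subseteq> {u}"
proof -
  obtain js where js: "set js = N" "distinct js" "length js \<le> 3"
    using N by (metis distinct_card finite_distinct_list)
  obtain w where "w \<in> U" using U by blast
  \<comment> \<open>With fewer than three terminals, an arbitrary vertex fills the free places of the tripod.\<close>
  define q where "q i = (if i < length js then p (js ! i) else w)" for i
  have q: "q i \<in> U" for i
    using N(3) js(1) \<open>w \<in> U\<close> by (auto simp: q_def)
  obtain u A B D where T: "u \<in> A" "u \<in> B" "u \<in> D" "q 0 \<in> A" "q 1 \<in> B" "q 2 \<in> D"
    "A \<subseteq> U" "B \<subseteq> U" "D \<subseteq> U" "connected_in E A" "connected_in E B" "connected_in E D"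
    "A \<inter> B \<subseteq> {u}" "A \<inter> D \<subseteq> {u}" "B \<inter> D \<subseteq> {u}"
    using obtain_tripod[OF U(1) q[of 0] q[of 1] q[of 2]] by metis
  define leg where "leg i = (if i = 0 then A else if i = 1 then B else D)" for i :: nat
  have leg: "leg i \<subseteq> U" "connected_in E (leg i)" "u \<in> leg i" for i
    using T by (auto simp: leg_def)
  have leg_q: "q i \<in> leg i" if "i < 3" for i
  proof -
    have "i = 0 \<or> i = 1 \<or> i = 2" using that by linarith
    then show ?thesis using T by (auto simp: leg_def)
  qed
  have leg_Int: "leg i \<inter> leg k \<subseteq> {u}" if "i < 3" "k < 3" "i \<noteq> k" for i k
  proof -
    have "(i = 0 \<or> i = 1 \<or> i = 2) \<and> (k = 0 \<or> k = 1 \<or> k = 2)" using that by linarith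
    then show ?thesis using T(13-15) that(3) by (auto simp: leg_def)
  qed
  have "\<forall>j\<in>N. \<exists>i. i < length js \<and> js ! i = j"
    using js(1) by (metis in_set_conv_nth)
  then obtain pos where pos: "\<And>j. j \<in> N \<Longrightarrow> pos j < length js \<and> js ! pos j = j"
    by metis
  show thesis
  proof (rule that[of u "\<lambda>j. leg (pos j)"])
    show "u \<in> U" using T by blast
    show "leg (pos j) \<subseteq> U \<and> connected_in E (leg (pos j)) \<and> u \<in> leg (pos j) \<and> p j \<in> leg (pos j)"
      if "j \<in> N" for j
    proof -
      have "p j = q (pos j)" using pos[OF that] by (simp add: q_def)
      with pos[OF that] js(3) leg leg_q show ?thesis by fastforce
    qed
    show "leg (pos j) \<inter> leg (pos k) \<subseteq> {u}" if "j \<in> N" "k \<in> N" "j \<noteq> k" for j k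
    proof (rule leg_Int)
      show "pos j < 3" "pos k < 3" using pos that js(3) by force+
      show "pos j \<noteq> pos k" using pos that by metis
    qed
  qed
qed

section \<open>Drawings of connected vertex sets\<close>

definition subdrawing :: "plane_map \<Rightarrow> complex set \<Rightarrow> complex set" where
  "subdrawing M W = W \<union> (\<Union>e\<in>{e \<in> edges M. e \<subseteq> W}. path_image (curve M e))"

lemma edge_curve:
  assumes "planar_map M" "{x, y} \<in> edges M"
  obtains g where "arc_between x y g" "path_image g = path_image (curve M {x, y})"
proof -
  let ?c = "curve M {x, y}"
  have "arc ?c" and ends: "{pathstart ?c, pathfinish ?c} = {x, y}"
    using assms by (auto simp: planar_map_def)
  then consider "arc_between x y ?c" | "arc_between y x ?c"
    by (auto simp: arc_between_def doubleton_eq_iff)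
  then show thesis
  proof cases
    case 2
    then show thesis using that[of "reversepath ?c"] arc_between_rev by fastforce
  qed (use that in blast)
qed

lemma arc_in_subdrawing:
  assumes "planar_map M" "connected_in (edges M) W" "x \<in> W" "y \<in> W" "x \<noteq> y"
  obtains g where "arc_between x y g" "path_image g \<subseteq> subdrawing M W"
proof -
  have "(x, y) \<in> (step_in (edges M) W)\<^sup>*"
    using assms by (auto simp: connected_in_def)
  then have "path_component (subdrawing M W) x y"
  proof (induction rule: rtrancl_induct)
    case base
    then show ?case using assms by (simp add: subdrawing_def path_component_refl)
  next
    case (step y z)
    then have yz: "{y, z} \<in> edges M" "{y, z} \<subseteq> W" by (auto simp: step_in_def)
    with edge_curve[OF assms(1)] obtain g where g: "arc_between y z g" "path_image g = path_image (curve M {y, z})"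
      by metis
    then have "path_image g \<subseteq> subdrawing M W"
      using yz by (auto simp: subdrawing_def)
    with g have "path_component (subdrawing M W) y z"
      unfolding path_component_def arc_between_def using arc_imp_path by metis
    with step.IH show ?case by (rule path_component_trans)
  qed
  then obtain p where p: "path p" "path_image p \<subseteq> subdrawing M W" "pathstart p = x" "pathfinish p = y"
    by (auto simp: path_component_def)
  with path_contains_arc[OF this(1,3,4) assms(5)] show thesis
    by (metis arc_between_def subset_trans that)
qed

text \<open>An edge inside both vertex sets would have two common vertices, and distinct edges meet only in
  common endpoints.\<close>

lemma subdrawing_Int:
  assumes M: "planar_map M" and W: "W \<subseteq> verts M" "W' \<subseteq> verts M" and one: "W \<inter> W' \<subseteq> {z}"
  shows "subdrawing M W \<inter> subdrawing M W' \<subseteq> W \<inter> W'"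
proof -
  have M': "card e = 2" "e \<subseteq> verts M" "path_image (curve M e) \<inter> verts M = e" if "e \<in> edges M" for e
    using M that by (auto simp: planar_map_def)
  have two: "\<not> e \<subseteq> W \<inter> W'" if "e \<in> edges M" for e
    using M'(1)[OF that] one card_mono[of "{z}" e] by auto
  have meet: "path_image (curve M e) \<inter> path_image (curve M f) = e \<inter> f"
    if "e \<in> edges M" "f \<in> edges M" "e \<noteq> f" for e f
    using M that by (auto simp: planar_map_def)
  show ?thesis
  proof
    fix q assume q: "q \<in> subdrawing M W \<inter> subdrawing M W'"
    then consider "q \<in> W" "q \<in> W'"
      | f where "q \<in> W" "f \<in> edges M" "f \<subseteq> W'" "q \<in> path_image (curve M f)"
      | e where "q \<in> W'" "e \<in> edges M" "e \<subseteq> W" "q \<in> path_image (curve M e)"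
      | e f where "e \<in> edges M" "e \<subseteq> W" "q \<in> path_image (curve M e)"
         "f \<in> edges M" "f \<subseteq> W'" "q \<in> path_image (curve M f)"
      by (auto simp: subdrawing_def)
    then show "q \<in> W \<inter> W'"
    proof cases
      case 4
      then have "e \<noteq> f" using two by blast
      with meet 4 show ?thesis by blast
    qed (use M'(3) W in blast)+
  qed
qed

lemma subdrawing_subset: "W \<subseteq> verts M \<Longrightarrow> subdrawing M W \<subseteq> drawing M"
  by (auto simp: subdrawing_def drawing_def)

section \<open>Forbidden minors of outerplanar maps\<close>

text \<open>A subdivision, drawn in \<open>M\<close>, of the pattern graph with vertex set \<open>I\<close> and adjacency \<open>H\<close>: the
  branch vertex \<open>z i\<close> is taken from the branch set \<open>X i\<close>, and the arc \<open>g i j\<close> draws the edge \<open>ij\<close>.\<close>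

definition drawn_subdivision ::
  "plane_map \<Rightarrow> nat set \<Rightarrow> (nat \<Rightarrow> nat \<Rightarrow> bool) \<Rightarrow> (nat \<Rightarrow> complex set) \<Rightarrow> (nat \<Rightarrow> complex) \<Rightarrow>
     (nat \<Rightarrow> nat \<Rightarrow> real \<Rightarrow> complex) \<Rightarrow> bool" where
  "drawn_subdivision M I H X z g \<longleftrightarrow> (\<forall>i\<in>I. z i \<in> X i) \<and>
    (\<forall>i j. H i j \<longrightarrow> arc_between (z i) (z j) (g i j) \<and> path_image (g i j) \<subseteq> drawing M) \<and>
    (\<forall>i j k l. H i j \<longrightarrow> H k l \<longrightarrow> {i, j} \<noteq> {k, l} \<longrightarrow>
       path_image (g i j) \<inter> path_image (g k l) \<subseteq> z ` ({i, j} \<inter> {k, l}))"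

text \<open>In a graph of maximum degree 3, a branch set needs at most three exits, and inside a
  connected set these can be joined to one centre by disjoint legs. Hence such a minor is already
  drawn by arcs that are disjoint up to common endpoints.\<close>

lemma cubic_minor_drawn:
  fixes X :: "nat \<Rightarrow> complex set"
  assumes M: "planar_map M"
    and X': "\<forall>i\<in>I. connected_in (edges M) (X i) \<and> X i \<noteq> {} \<and> X i \<subseteq> verts M"
    and disj': "\<forall>i\<in>I. \<forall>j\<in>I. i \<noteq> j \<longrightarrow> X i \<inter> X j = {}"
    and H': "\<forall>i j. H i j \<longrightarrow> i \<in> I \<and> i \<noteq> j \<and> H j i"
    and deg': "\<forall>i\<in>I. finite {j. H i j} \<and> card {j. H i j} \<le> 3"
    and adj': "\<forall>i j. H i j \<longrightarrow> i < j \<longrightarrow> (\<exists>x\<in>X i. \<exists>y\<in>X j. {x, y} \<in> edges M)"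
  shows "\<exists>z g. drawn_subdivision M I H X z g"
proof -
  note X = X'[rule_format] and disj = disj'[rule_format] and H = H'[rule_format] and deg = deg'[rule_format]
    and adj = adj'[rule_format]
  have "\<forall>i j. \<exists>c. H i j \<and> i < j \<longrightarrow> fst c \<in> X i \<and> snd c \<in> X j \<and> {fst c, snd c} \<in> edges M"
    using adj by (metis fst_conv snd_conv)
  then obtain c where c: "\<And>i j. H i j \<Longrightarrow> i < j \<Longrightarrow>
      fst (c i j) \<in> X i \<and> snd (c i j) \<in> X j \<and> {fst (c i j), snd (c i j)} \<in> edges M"
    by metis
  \<comment> \<open>The edge chosen for \<open>ij\<close> must also serve \<open>ji\<close>, so it is chosen for \<open>i < j\<close> only.\<close>
  define p where "p i j = (if i < j then fst (c i j) else snd (c j i))" for i j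
  have p: "p i j \<in> X i" "{p i j, p j i} \<in> edges M" if "H i j" for i j
  proof -
    have "H j i" "i \<noteq> j" using H[OF that] by auto
    then show "p i j \<in> X i" "{p i j, p j i} \<in> edges M"
      using c[of i j] c[of j i] that by (auto simp: p_def insert_commute)
  qed
  have "\<exists>uL. \<forall>i\<in>I. fst (uL i) \<in> X i \<and>
      (\<forall>j. H i j \<longrightarrow> snd (uL i) j \<subseteq> X i \<and> connected_in (edges M) (snd (uL i) j) \<and>
         fst (uL i) \<in> snd (uL i) j \<and> p i j \<in> snd (uL i) j) \<and>
      (\<forall>j k. H i j \<longrightarrow> H i k \<longrightarrow> j \<noteq> k \<longrightarrow> snd (uL i) j \<inter> snd (uL i) k \<subseteq> {fst (uL i)})"
  proof (rule bchoice, rule ballI)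
    fix i assume i: "i \<in> I"
    obtain u L where "u \<in> X i"
      "\<And>j. j \<in> {j. H i j} \<Longrightarrow> L j \<subseteq> X i \<and> connected_in (edges M) (L j) \<and> u \<in> L j \<and> p i j \<in> L j"
      "\<And>j k. j \<in> {j. H i j} \<Longrightarrow> k \<in> {j. H i j} \<Longrightarrow> j \<noteq> k \<Longrightarrow> L j \<inter> L k \<subseteq> {u}"
      using obtain_star[of "edges M" "X i" "{j. H i j}" "p i"] X[OF i] deg[OF i] p(1)
      by (metis mem_Collect_eq)
    then show "\<exists>uL. fst uL \<in> X i \<and>
      (\<forall>j. H i j \<longrightarrow> snd uL j \<subseteq> X i \<and> connected_in (edges M) (snd uL j) \<and> fst uL \<in> snd uL j \<and> p i j \<in> snd uL j) \<and>
      (\<forall>j k. H i j \<longrightarrow> H i k \<longrightarrow> j \<noteq> k \<longrightarrow> snd uL j \<inter> snd uL k \<subseteq> {fst uL})"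
      by (intro exI[of _ "(u, L)"]) simp
  qed
  then obtain uL where uL: "\<And>i. i \<in> I \<Longrightarrow> fst (uL i) \<in> X i \<and>
      (\<forall>j. H i j \<longrightarrow> snd (uL i) j \<subseteq> X i \<and> connected_in (edges M) (snd (uL i) j) \<and>
         fst (uL i) \<in> snd (uL i) j \<and> p i j \<in> snd (uL i) j) \<and>
      (\<forall>j k. H i j \<longrightarrow> H i k \<longrightarrow> j \<noteq> k \<longrightarrow> snd (uL i) j \<inter> snd (uL i) k \<subseteq> {fst (uL i)})"
    by blast
  define z L where "z i = fst (uL i)" and "L i = snd (uL i)" for i
  have z: "z i \<in> X i" if "i \<in> I" for i
    using uL that by (simp add: z_def)
  have L: "L i j \<subseteq> X i" "connected_in (edges M) (L i j)" "z i \<in> L i j" "p i j \<in> L i j" if "H i j" for i j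
    using uL H that by (auto simp: z_def L_def)
  have LI: "L i j \<inter> L i k \<subseteq> {z i}" if "H i j" "H i k" "j \<noteq> k" for i j k
    using uL H that unfolding z_def L_def by metis
  define W where "W i j = L i j \<union> L j i" for i j
  have W_verts: "W i j \<subseteq> verts M" if "H i j" for i j
  proof -
    have ji: "H j i" "i \<in> I" "j \<in> I" using H that by blast+
    then show ?thesis
      using L(1)[OF that] L(1)[OF ji(1)] X[OF ji(2)] X[OF ji(3)] unfolding W_def by blast
  qed
  have "\<forall>i j. \<exists>g. H i j \<longrightarrow> arc_between (z i) (z j) g \<and> path_image g \<subseteq> subdrawing M (W i j)"
  proof (intro allI)
    fix i j
    show "\<exists>g. H i j \<longrightarrow> arc_between (z i) (z j) g \<and> path_image g \<subseteq> subdrawing M (W i j)"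
    proof (cases "H i j")
      case True
      then have ji: "H j i" "i \<noteq> j" "i \<in> I" "j \<in> I" using H by blast+
      have conn: "connected_in (edges M) (W i j)"
        unfolding W_def
        by (rule connected_in_Un[OF L(2)[OF True] L(2)[OF ji(1)] L(4)[OF True] L(4)[OF ji(1)]])
           (simp add: p(2)[OF True])
      have "z i \<noteq> z j"
        using z[OF ji(3)] z[OF ji(4)] disj[OF ji(3,4,2)] by (metis disjoint_iff)
      moreover have "z i \<in> W i j" "z j \<in> W i j"
        using L(3)[OF True] L(3)[OF ji(1)] by (simp_all add: W_def)
      ultimately show ?thesis
        using arc_in_subdrawing[OF M conn] by metis
    qed simp
  qed
  then obtain g where g: "\<And>i j. H i j \<Longrightarrow> arc_between (z i) (z j) (g i j) \<and> path_image (g i j) \<subseteq> subdrawing M (W i j)"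
    by metis
  have W_Int: "W i j \<inter> W k l \<subseteq> z ` ({i, j} \<inter> {k, l})" if "H i j" "H k l" "{i, j} \<noteq> {k, l}" for i j k l
  proof
    fix w assume "w \<in> W i j \<inter> W k l"
    then obtain a b a' b' where ab: "w \<in> L a b" "w \<in> L a' b'" "{a, b} = {i, j}" "{a', b'} = {k, l}"
      unfolding W_def by blast
    then have Hab: "H a b" "H a' b'"
      using that H by (auto simp: doubleton_eq_iff)
    have "w \<in> X a" "w \<in> X a'" using L(1)[OF Hab(1)] L(1)[OF Hab(2)] ab by blast+
    then have "a = a'"
      using disj[of a a'] H[OF Hab(1)] H[OF Hab(2)] by blast
    moreover have "b \<noteq> b'" using ab that calculation by blast
    ultimately have "w = z a" using LI[of a b b'] Hab ab by blast
    with ab \<open>a = a'\<close> show "w \<in> z ` ({i, j} \<inter> {k, l})" by blast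
  qed
  show ?thesis
    unfolding drawn_subdivision_def
  proof (intro exI[of _ z] exI[of _ g] conjI ballI allI impI)
    show "z i \<in> X i" if "i \<in> I" for i using z that .
    show "arc_between (z i) (z j) (g i j)" "path_image (g i j) \<subseteq> drawing M" if "H i j" for i j
      using g[OF that] subdrawing_subset[OF W_verts[OF that]] by blast+
    show "path_image (g i j) \<inter> path_image (g k l) \<subseteq> z ` ({i, j} \<inter> {k, l})"
      if h: "H i j" "H k l" "{i, j} \<noteq> {k, l}" for i j k l
    proof -
      obtain m where "{i, j} \<inter> {k, l} \<subseteq> {m}" using h(3) H[OF h(1)] H[OF h(2)] by blast
      then have "W i j \<inter> W k l \<subseteq> {z m}" using W_Int[OF h] by blast
      from subdrawing_Int[OF M W_verts[OF h(1)] W_verts[OF h(2)] this] g[OF h(1)] g[OF h(2)] W_Int[OF h]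
      show ?thesis by (meson Int_mono subset_trans)
    qed
  qed
qed

text \<open>A point enclosed by a closed part of the drawing has a neighbourhood that avoids the outer
  face.\<close>

lemma vertex_not_inside:
  assumes "outerplanar_map M" "v \<in> verts M" "closed C" "C \<subseteq> drawing M"
  shows "v \<notin> inside C"
proof
  assume v: "v \<in> inside C"
  have "v \<in> closure (outside (drawing M))"
    using assms by (auto simp: outerplanar_map_def on_outer_face_def outer_face_def frontier_def)
  moreover have "open (inside C)" using assms by (simp add: open_inside)
  ultimately have "inside C \<inter> outside (drawing M) \<noteq> {}"
    using v by (metis disjoint_iff open_Int_closure_eq_empty)
  then show False
    using outside_mono[OF assms(4)] inside_Int_outside[of C] by blast
qed

text \<open>In a drawn subdivision of \<open>K\<^sub>4\<close>, the 4-cycle \<open>0 2 1 3\<close> has the crossing chords \<open>01\<close> and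
  \<open>23\<close>.\<close>

lemma no_K4_minor:
  fixes X :: "nat \<Rightarrow> complex set"
  assumes M: "outerplanar_map M"
    and X: "\<And>i. i < 4 \<Longrightarrow> connected_in (edges M) (X i) \<and> X i \<noteq> {} \<and> X i \<subseteq> verts M"
    and disj: "\<And>i j. i < 4 \<Longrightarrow> j < 4 \<Longrightarrow> i < j \<Longrightarrow> X i \<inter> X j = {}"
    and adj: "\<And>i j. i < 4 \<Longrightarrow> j < 4 \<Longrightarrow> i < j \<Longrightarrow> \<exists>x\<in>X i. \<exists>y\<in>X j. {x, y} \<in> edges M"
  shows False
proof -
  define H where "H i j \<longleftrightarrow> i < 4 \<and> j < 4 \<and> i \<noteq> j" for i j :: nat
  have pm: "planar_map M" using M by (simp add: outerplanar_map_def)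
  have deg: "\<forall>i\<in>{..<4}. finite {j. H i j} \<and> card {j. H i j} \<le> 3"
  proof
    fix i :: nat assume i: "i \<in> {..<4}"
    then have "{j. H i j} = {..<4} - {i}" by (auto simp: H_def)
    then show "finite {j. H i j} \<and> card {j. H i j} \<le> 3" using i by simp
  qed
  have disj': "\<forall>i\<in>{..<4}. \<forall>j\<in>{..<4}. i \<noteq> j \<longrightarrow> X i \<inter> X j = {}"
    using disj by (metis Int_commute lessThan_iff linorder_neqE_nat)
  have X': "\<forall>i\<in>{..<4}. connected_in (edges M) (X i) \<and> X i \<noteq> {} \<and> X i \<subseteq> verts M"
    using X by simp
  have H: "\<forall>i j. H i j \<longrightarrow> i \<in> {..<4} \<and> i \<noteq> j \<and> H j i"
    by (auto simp: H_def)
  have adj': "\<forall>i j. H i j \<longrightarrow> i < j \<longrightarrow> (\<exists>x\<in>X i. \<exists>y\<in>X j. {x, y} \<in> edges M)"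
    using adj by (auto simp: H_def)
  from cubic_minor_drawn[OF pm X' disj' H deg adj'] obtain z g where
    zg: "drawn_subdivision M {..<4} H X z g" by blast
  note z = zg[unfolded drawn_subdivision_def, THEN conjunct1, rule_format]
    and g = zg[unfolded drawn_subdivision_def, THEN conjunct2, THEN conjunct1, rule_format]
    and Int = zg[unfolded drawn_subdivision_def, THEN conjunct2, THEN conjunct2, rule_format]
  show False
  proof (rule no_crossing_chords[of "z 0" "z 2" "g 0 2" "z 1" "g 2 1" "z 3" "g 0 3" "g 3 1" "g 0 1" "g 2 3"])
    show "q \<notin> inside C"
      if "C \<subseteq> path_image (g 0 2) \<union> path_image (g 2 1) \<union> path_image (g 0 3) \<union> path_image (g 3 1) \<union>
            path_image (g 0 1) \<union> path_image (g 2 3)"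
        "closed C" "q \<in> {z 0, z 1, z 2, z 3}" for C q
    proof (rule vertex_not_inside[OF M _ that(2)])
      have "z i \<in> verts M" if "i < 4" for i using z[of i] X[of i] that by auto
      with that(3) show "q \<in> verts M" by auto
      have "path_image (g i j) \<subseteq> drawing M" if "i < 4" "j < 4" "i \<noteq> j" for i j
        using g[of i j] that by (simp add: H_def)
      then have "path_image (g 0 2) \<union> path_image (g 2 1) \<union> path_image (g 0 3) \<union> path_image (g 3 1) \<union>
          path_image (g 0 1) \<union> path_image (g 2 3) \<subseteq> drawing M"
        by (intro Un_least) simp_all
      with that(1) show "C \<subseteq> drawing M" by (rule subset_trans)
    qed
  qed (use g[of 0 2] g[of 2 1] g[of 0 3] g[of 3 1] g[of 0 1] g[of 2 3] Int[of 0 2 2 1] Int[of 0 2 0 3] Int[of 0 2 3 1] Int[of 2 1 0 3] Int[of 2 1 3 1] Int[of 0 3 3 1]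
        Int[of 0 1 0 2] Int[of 0 1 2 1] Int[of 0 1 0 3] Int[of 0 1 3 1]
        Int[of 2 3 0 2] Int[of 2 3 2 1] Int[of 2 3 0 3] Int[of 2 3 3 1] Int[of 0 1 2 3]
       in \<open>simp_all add: H_def doubleton_eq_iff\<close>)
qed

text \<open>The vertices \<open>0\<close> and \<open>1\<close> of the pattern form one side of \<open>K\<^sub>2\<^sub>,\<^sub>3\<close>. In a drawn subdivision,
  each of the three paths between their branch vertices has a vertex in its interior that no cycle
  encloses. The vertices on two of the paths force the third path into the inside of the cycle
  formed by these two, contrary to the vertex that it carries.\<close>

lemma no_K23_minor:
  fixes X :: "nat \<Rightarrow> complex set"
  assumes M: "outerplanar_map M"
    and X: "\<And>i. i < 5 \<Longrightarrow> connected_in (edges M) (X i) \<and> X i \<noteq> {} \<and> X i \<subseteq> verts M"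
    and disj: "\<And>i j. i < 5 \<Longrightarrow> j < 5 \<Longrightarrow> i < j \<Longrightarrow> X i \<inter> X j = {}"
    and adj: "\<And>i j. i < 2 \<Longrightarrow> 2 \<le> j \<Longrightarrow> j < 5 \<Longrightarrow> \<exists>x\<in>X i. \<exists>y\<in>X j. {x, y} \<in> edges M"
  shows False
proof -
  define H where "H i j \<longleftrightarrow> i < 5 \<and> j < 5 \<and> (i < 2 \<longleftrightarrow> 2 \<le> j)" for i j :: nat
  have pm: "planar_map M" using M by (simp add: outerplanar_map_def)
  have deg: "\<forall>i\<in>{..<5}. finite {j. H i j} \<and> card {j. H i j} \<le> 3"
  proof (rule ballI)
    fix i
    show "finite {j. H i j} \<and> card {j. H i j} \<le> 3"
    proof (cases "i < 2")
      case True
      then have "{j. H i j} = {2..<5}" by (auto simp: H_def)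
      then show ?thesis by simp
    next
      case False
      then have "{j. H i j} \<subseteq> {..<2}" by (auto simp: H_def)
      then have "finite {j. H i j}" "card {j. H i j} \<le> card {..<2::nat}"
        by (auto intro: finite_subset simp del: card_lessThan intro!: card_mono)
      then show ?thesis by simp
    qed
  qed
  have disj': "\<forall>i\<in>{..<5}. \<forall>j\<in>{..<5}. i \<noteq> j \<longrightarrow> X i \<inter> X j = {}"
    using disj by (metis Int_commute lessThan_iff linorder_neqE_nat)
  have X': "\<forall>i\<in>{..<5}. connected_in (edges M) (X i) \<and> X i \<noteq> {} \<and> X i \<subseteq> verts M"
    using X by simp
  have H: "\<forall>i j. H i j \<longrightarrow> i \<in> {..<5} \<and> i \<noteq> j \<and> H j i"
    unfolding H_def by (intro allI impI) auto
  have adj': "\<forall>i j. H i j \<longrightarrow> i < j \<longrightarrow> (\<exists>x\<in>X i. \<exists>y\<in>X j. {x, y} \<in> edges M)"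
    using adj by (auto simp: H_def)
  from cubic_minor_drawn[OF pm X' disj' H deg adj'] obtain z g where
    zg: "drawn_subdivision M {..<5} H X z g" by blast
  note z = zg[unfolded drawn_subdivision_def, THEN conjunct1, rule_format]
    and g = zg[unfolded drawn_subdivision_def, THEN conjunct2, THEN conjunct1, rule_format]
    and Int = zg[unfolded drawn_subdivision_def, THEN conjunct2, THEN conjunct2, rule_format]
  have H0: "H 0 i" and H1: "H i 1" if "i \<in> {2, 3, 4}" for i
    using that by (auto simp: H_def)
  define c where "c i = g 0 i +++ g i 1" for i
  have c: "arc_between (z 0) (z 1) (c i)" "path_image (c i) = path_image (g 0 i) \<union> path_image (g i 1)"
    if "i \<in> {2, 3, 4}" for i
  proof -
    have "arc_between (z 0) (z i) (g 0 i)" "arc_between (z i) (z 1) (g i 1)"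
      "path_image (g 0 i) \<inter> path_image (g i 1) \<subseteq> {z i}"
      using g[OF H0[OF that]] g[OF H1[OF that]] Int[OF H0[OF that] H1[OF that]] that
      by (auto simp: doubleton_eq_iff)
    then show "arc_between (z 0) (z 1) (c i)" "path_image (c i) = path_image (g 0 i) \<union> path_image (g i 1)"
      unfolding c_def by (rule arc_between_join)+
  qed
  have c_draw: "path_image (c i) \<subseteq> drawing M" if "i \<in> {2, 3, 4}" for i
    using c(2)[OF that] g[OF H0[OF that]] g[OF H1[OF that]] by simp
  have c_Int: "path_image (c i) \<inter> path_image (c k) \<subseteq> {z 0, z 1}"
    if "i \<in> {2, 3, 4}" "k \<in> {2, 3, 4}" "i \<noteq> k" for i k
  proof -
    note h = H0[OF that(1)] H1[OF that(1)] H0[OF that(2)] H1[OF that(2)]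
    have ne: "i \<noteq> 0" "i \<noteq> 1" "k \<noteq> 0" "k \<noteq> 1" using that by auto
    have "path_image (g 0 i) \<inter> path_image (g 0 k) \<subseteq> {z 0}"
      using Int[OF h(1,3)] ne that(3) by (auto simp: doubleton_eq_iff)
    moreover have "path_image (g 0 i) \<inter> path_image (g k 1) \<subseteq> {}"
      using Int[OF h(1,4)] ne that(3) by (auto simp: doubleton_eq_iff)
    moreover have "path_image (g i 1) \<inter> path_image (g 0 k) \<subseteq> {}"
      using Int[OF h(2,3)] ne that(3) by (auto simp: doubleton_eq_iff)
    moreover have "path_image (g i 1) \<inter> path_image (g k 1) \<subseteq> {z 1}"
      using Int[OF h(2,4)] ne that(3) by (auto simp: doubleton_eq_iff)
    ultimately show ?thesis
      unfolding c(2)[OF that(1)] c(2)[OF that(2)] by blast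
  qed
  have th: "theta (z 0) (z 1) (c 2) (c 3) (c 4)"
    unfolding theta_def using c(1) c_Int by simp
  have mid: "z i \<in> path_image (c i)" "z i \<notin> {z 0, z 1}" if "i \<in> {2, 3, 4}" for i
  proof -
    show "z i \<in> path_image (c i)"
      using g[OF H0[OF that]] arc_between_ends(2) c(2)[OF that] by blast
    show "z i \<notin> {z 0, z 1}"
      using g[OF H0[OF that]] g[OF H1[OF that]] arc_between_ends(3)[of "z 0" "z i"] arc_between_ends(3)[of "z i" "z 1"]
      by auto
  qed
  have out: "z i \<notin> inside (path_image (c j) \<union> path_image (c k))"
    if "i \<in> {2, 3, 4}" "j \<in> {2, 3, 4}" "k \<in> {2, 3, 4}" for i j k
  proof (rule vertex_not_inside[OF M])
    show "z i \<in> verts M" using z[of i] X[of i] that(1) by auto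
    show "closed (path_image (c j) \<union> path_image (c k))"
      using c(1) that by (intro closed_Un closed_arc_image) (auto simp: arc_between_def)
    show "path_image (c j) \<union> path_image (c k) \<subseteq> drawing M"
      using c_draw that by blast
  qed
  have "path_image (c 4) - {z 0, z 1} \<subseteq> inside (path_image (c 2) \<union> path_image (c 3))"
    by (rule theta_chord_inside[OF th, of "z 2" "z 3"]) (use mid out in simp_all)
  with mid[of 4] out[of 4 2 3] show False by auto
qed


section \<open>Vertices of degree at most two\<close>

definition graph :: "'a set \<Rightarrow> 'a set set \<Rightarrow> bool" where
  "graph V E \<longleftrightarrow> finite V \<and> (\<forall>e\<in>E. e \<subseteq> V \<and> card e = 2)"

definition nbrs :: "'a set set \<Rightarrow> 'a \<Rightarrow> 'a set" where
  "nbrs E v = {u. {v, u} \<in> E}"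

lemma in_nbrs_iff: "u \<in> nbrs E v \<longleftrightarrow> {v, u} \<in> E"
  by (simp add: nbrs_def)

lemma nbrs_sym: "u \<in> nbrs E v \<longleftrightarrow> v \<in> nbrs E u"
  by (simp add: nbrs_def insert_commute)

lemma graph_nbrs:
  assumes "graph V E"
  shows "nbrs E v \<subseteq> V" "finite (nbrs E v)" "v \<notin> nbrs E v"
proof -
  show "nbrs E v \<subseteq> V" using assms by (auto simp: graph_def nbrs_def)
  then show "finite (nbrs E v)" using assms finite_subset by (auto simp: graph_def)
  show "v \<notin> nbrs E v" using assms by (force simp: graph_def nbrs_def)
qed

definition component_of :: "'a set set \<Rightarrow> 'a set \<Rightarrow> 'a \<Rightarrow> 'a set" where
  "component_of E A x = {y. (x, y) \<in> (step_in E A)\<^sup>*}"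

lemma component_of_self: "x \<in> component_of E A x"
  by (simp add: component_of_def)

lemma component_of_subset: "x \<in> A \<Longrightarrow> component_of E A x \<subseteq> A"
  by (auto simp: component_of_def dest: step_in_rtrancl_mem)

lemma component_of_closed:
  assumes "y \<in> component_of E A x" "x \<in> A" "{y, z} \<in> E" "z \<in> A"
  shows "z \<in> component_of E A x"
proof -
  have "y \<in> A" using assms component_of_subset by fast
  then have "(y, z) \<in> step_in E A" using assms by (simp add: step_in_def)
  with assms(1) show ?thesis by (auto simp: component_of_def)
qed

lemma connected_in_component_of: "connected_in E (component_of E A x)"
proof -
  let ?C = "component_of E A x"
  have from_x: "(x, y) \<in> (step_in E ?C)\<^sup>*" if "(x, y) \<in> (step_in E A)\<^sup>*" for y
    using that
  proof (induction rule: rtrancl_induct)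
    case (step y z)
    then have "y \<in> ?C" "z \<in> ?C"
      by (auto simp: component_of_def)
    with step.hyps(2) have "(y, z) \<in> step_in E ?C" by (simp add: step_in_def)
    with step.IH show ?case by simp
  qed simp
  show ?thesis
    unfolding connected_in_def
  proof (intro ballI)
    fix y z assume "y \<in> ?C" "z \<in> ?C"
    then have "(x, y) \<in> (step_in E ?C)\<^sup>*" "(x, z) \<in> (step_in E ?C)\<^sup>*"
      using from_x by (auto simp: component_of_def)
    then show "(y, z) \<in> (step_in E ?C)\<^sup>*"
      using step_in_rtrancl_sym rtrancl_trans by metis
  qed
qed

text \<open>A moment in a depth-first search: \<open>p\<close> is the search path with the current vertex at its head,
  and \<open>K\<close> is a connected set of unvisited vertices that the current vertex can enter and whose
  other neighbours all lie on the path. The vertex \<open>t\<close>, for which no lower bound on the degree will be assumed,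
  must not be in \<open>K\<close>.\<close>

definition search_state :: "'a set \<Rightarrow> 'a set set \<Rightarrow> 'a \<Rightarrow> 'a list \<Rightarrow> 'a set \<Rightarrow> bool" where
  "search_state V E t p K \<longleftrightarrow>
     p \<noteq> [] \<and> distinct p \<and> is_walk E p \<and> set p \<subseteq> V \<and>
     connected_in E K \<and> K \<subseteq> V \<and> t \<notin> K \<and> K \<inter> set p = {} \<and>
     (\<forall>x\<in>K. nbrs E x \<subseteq> K \<union> set p) \<and> nbrs E (hd p) \<inter> K \<noteq> {}"

text \<open>When the search moves to \<open>c\<close>, every component of \<open>K - {c}\<close> is entered from \<open>c\<close>, because
  \<open>K\<close> is connected.\<close>

lemma search_step:
  assumes st: "search_state V E t p K"
    and c: "c \<in> nbrs E (hd p) \<inter> K" and x: "x \<in> K" "x \<noteq> c"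
  shows "search_state V E t (c # p) (component_of E (K - {c}) x)" (is ?S)
    and "component_of E (K - {c}) x \<subset> K"
proof -
  let ?K = "component_of E (K - {c}) x"
  have sub: "?K \<subseteq> K - {c}"
    using x by (intro component_of_subset) auto
  then show "?K \<subset> K" using c by blast
  have touch: "y \<in> ?K \<or> (\<exists>w\<in>?K. {c, w} \<in> E)" if "(x, y) \<in> (step_in E K)\<^sup>*" for y
    using that
  proof (induction rule: rtrancl_induct)
    case base
    then show ?case by (simp add: component_of_self)
  next
    case (step y z)
    then have yz: "{y, z} \<in> E" "z \<in> K" by (auto simp: step_in_def)
    show ?case
    proof (cases "y \<in> ?K \<and> z \<noteq> c")
      case True
      then have "z \<in> ?K"
        using yz x component_of_closed[of y E "K - {c}" x z] by simp
      then show ?thesis ..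
    next
      case False
      with step.IH yz show ?thesis by (auto simp: insert_commute)
    qed
  qed
  have "(x, c) \<in> (step_in E K)\<^sup>*"
    using st c x by (auto simp: search_state_def connected_in_def)
  from touch[OF this] sub have adj: "nbrs E c \<inter> ?K \<noteq> {}"
    by (auto simp: nbrs_def)
  have cl: "nbrs E y \<subseteq> ?K \<union> set (c # p)" if "y \<in> ?K" for y
  proof
    fix z assume z: "z \<in> nbrs E y"
    have "\<forall>y\<in>K. nbrs E y \<subseteq> K \<union> set p" using st by (simp add: search_state_def)
    with sub that z have "z \<in> K \<union> set p" by blast
    moreover have "z \<in> ?K" if "z \<in> K" "z \<noteq> c"
      using \<open>y \<in> ?K\<close> z x that component_of_closed[of y E "K - {c}" x z] by (simp add: in_nbrs_iff)
    ultimately show "z \<in> ?K \<union> set (c # p)" by auto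
  qed
  have "is_walk E (c # p)" "distinct (c # p)"
    using st c by (auto simp: search_state_def successively_Cons in_nbrs_iff insert_commute)
  then show ?S
    using st sub adj cl connected_in_component_of[of E "K - {c}" x] c
    unfolding search_state_def by auto
qed

lemma two_elements:
  assumes "2 \<le> card A"
  obtains a b where "a \<in> A" "b \<in> A" "a \<noteq> b"
proof -
  have "finite A" using assms by (metis card.infinite not_numeral_le_zero)
  then show thesis
    using assms that card_le_Suc0_iff_eq[of A] by fastforce
qed

text \<open>By the last assumption the current vertex never has a choice between two vertices of \<open>K\<close>.
  Descending by the only available edge ends in a vertex \<open>l\<close> all of whose neighbours lie on the
  search path. Since each vertex passed had just one neighbour among the vertices then unvisited,
  \<open>l\<close> is adjacent, apart from its predecessor, only to vertices strictly above the starting point.\<close>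

lemma deep_vertex:
  assumes G: "graph V E" and deg: "\<forall>v\<in>V. v \<noteq> t \<longrightarrow> 3 \<le> card (nbrs E v)"
    and "search_state V E t q K"
    and "\<And>q' K'. search_state V E t q' K' \<Longrightarrow> card K' \<le> card K \<Longrightarrow> card (nbrs E (hd q') \<inter> K') \<le> 1"
  shows "\<exists>l\<in>K. 2 \<le> card (nbrs E l \<inter> set (tl q))"
  using assms(3,4)
proof (induction "card K" arbitrary: q K rule: less_induct)
  case less
  note st = less.prems(1)
  have fin: "finite K"
    using st G finite_subset by (auto simp: search_state_def graph_def)
  have q: "set q = insert (hd q) (set (tl q))"
    using st by (cases q) (auto simp: search_state_def)
  obtain c where c: "c \<in> nbrs E (hd q) \<inter> K" using st by (auto simp: search_state_def)
  have uniq: "y = c" if "y \<in> nbrs E (hd q) \<inter> K" for y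
    using less.prems(2)[OF st order.refl] c that fin
    by (metis One_nat_def card_le_Suc0_iff_eq finite_Int)
  show ?case
  proof (cases "K = {c}")
    case True
    have cV: "c \<in> V" "c \<noteq> t" using st c by (auto simp: search_state_def)
    have "nbrs E c \<subseteq> K \<union> set q" using st c by (auto simp: search_state_def)
    then have "nbrs E c - {hd q} \<subseteq> nbrs E c \<inter> set (tl q)"
      using True q graph_nbrs(3)[OF G] by blast
    then have "card (nbrs E c - {hd q}) \<le> card (nbrs E c \<inter> set (tl q))"
      by (intro card_mono) auto
    moreover have "card (nbrs E c) - 1 \<le> card (nbrs E c - {hd q})"
      by (simp add: card_Diff_singleton_if)
    ultimately have "2 \<le> card (nbrs E c \<inter> set (tl q))"
      using deg cV by fastforce
    with c show ?thesis by blast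
  next
    case False
    then obtain x where x: "x \<in> K" "x \<noteq> c" using c by blast
    let ?K = "component_of E (K - {c}) x"
    note step = search_step[OF st c x]
    then have "card ?K < card K" using fin by (intro psubset_card_mono)
    then obtain l where l: "l \<in> ?K" "2 \<le> card (nbrs E l \<inter> set q)"
      using less.hyps[OF _ step(1)] less.prems(2) by fastforce
    have "l \<in> K" "l \<noteq> c" using l(1) component_of_subset[of x "K - {c}" E] x by auto
    then have "hd q \<notin> nbrs E l"
      using uniq[of l] by (auto simp: nbrs_sym[of l])
    then have "nbrs E l \<inter> set q = nbrs E l \<inter> set (tl q)" by (subst q) simp
    with l \<open>l \<in> K\<close> show ?thesis by auto
  qed
qed

lemma outerplanar_graph: "outerplanar_map M \<Longrightarrow> graph (verts M) (edges M)"
  by (auto simp: outerplanar_map_def planar_map_def graph_def)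

text \<open>Suppose that all vertices other than \<open>t\<close> have degree at least 3. Take a state of the search, with
  \<open>K\<close> as small as possible, in which the current vertex has two neighbours \<open>c\<close> and \<open>x\<close> in \<open>K\<close>.
  By minimality, each component of \<open>K - {c}\<close> meets the situation of the previous lemma and thus has
  an edge to the set \<open>U\<close> of path vertices above the current one. If \<open>c\<close> has a neighbour in \<open>U\<close>,
  then \<open>c\<close>, the current vertex, \<open>U\<close> and the component of \<open>x\<close> form a \<open>K\<^sub>4\<close> minor. Otherwise the
  degree of \<open>c\<close> forces a second component, and \<open>c\<close> and \<open>U\<close> are both adjacent to the current vertex
  and to two components: a \<open>K\<^sub>2\<^sub>,\<^sub>3\<close> minor.\<close>

theorem low_degree_vertex:
  assumes M: "outerplanar_map M" and t: "t \<in> verts M" and two: "2 \<le> card (verts M)"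
  shows "\<exists>v\<in>verts M. v \<noteq> t \<and> card (nbrs (edges M) v) \<le> 2"
proof (rule ccontr)
  assume *: "\<not> ?thesis"
  define V E where "V = verts M" and "E = edges M"
  note G = outerplanar_graph[OF M, folded V_def E_def]
  have finV: "finite V" using G by (simp add: graph_def)
  have deg': "\<forall>v\<in>V. v \<noteq> t \<longrightarrow> 3 \<le> card (nbrs E v)"
    using * by (force simp: V_def E_def)
  note deg = deg'[rule_format]
  define branching where "branching p K \<longleftrightarrow> search_state V E t p K \<and> 2 \<le> card (nbrs E (hd p) \<inter> K)" for p K
  have "\<exists>p K. branching p K"
  proof (rule ccontr)
    assume none: "\<not> (\<exists>p K. branching p K)"
    \<comment> \<open>The search starts at \<open>t\<close>; if \<open>t\<close> is isolated, it starts elsewhere and cannot reach \<open>t\<close>.\<close>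
    have "\<exists>r\<in>V. nbrs E r \<noteq> {} \<and> (r = t \<or> nbrs E t = {})"
    proof (cases "nbrs E t = {}")
      case True
      obtain r where "r \<in> V" "r \<noteq> t" using two_elements[OF two[folded V_def]] by metis
      with deg[of r] have "nbrs E r \<noteq> {}" by auto
      with True \<open>r \<in> V\<close> show ?thesis by blast
    next
      case False
      then show ?thesis using t by (auto simp: V_def)
    qed
    then obtain r x where r: "r \<in> V" "x \<in> nbrs E r" "r = t \<or> nbrs E t = {}" by blast
    have x: "x \<in> V - {r}" using r graph_nbrs[OF G] by blast
    let ?K = "component_of E (V - {r}) x"
    have sub: "?K \<subseteq> V - {r}" using component_of_subset[OF x] .
    have "t \<notin> ?K"
    proof
      assume tK: "t \<in> ?K"
      with sub r have "nbrs E t = {}" by blast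
      then have "t \<noteq> x" using r(2) by (auto simp: nbrs_sym[of x])
      with tK obtain y where "(y, t) \<in> step_in E (V - {r})"
        unfolding component_of_def by (metis mem_Collect_eq rtranclE)
      with \<open>nbrs E t = {}\<close> show False by (auto simp: step_in_def nbrs_def insert_commute)
    qed
    moreover have "nbrs E y \<subseteq> ?K \<union> {r}" if "y \<in> ?K" for y
      using component_of_closed[OF that x] graph_nbrs(1)[OF G, of y] unfolding nbrs_def by blast
    moreover have "x \<in> ?K" by (rule component_of_self)
    ultimately have "search_state V E t [r] ?K"
      using sub r connected_in_component_of[of E "V - {r}" x] by (auto simp: search_state_def)
    \<comment> \<open>Nothing lies above the starting point, so some state must offer a choice.\<close>
    then have "\<exists>l\<in>?K. 2 \<le> card (nbrs E l \<inter> set (tl [r]))"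
    proof (rule deep_vertex[OF G deg'])
      fix q' K' assume "search_state V E t q' K'"
      with none show "card (nbrs E (hd q') \<inter> K') \<le> 1" by (force simp: branching_def)
    qed
    then show False by simp
  qed
  then obtain p0 K0 where "branching p0 K0" by blast
  then have "\<exists>pK. branching (fst pK) (snd pK) \<and>
      (\<forall>pK'. branching (fst pK') (snd pK') \<longrightarrow> card (snd pK) \<le> card (snd pK'))"
    using ex_has_least_nat[of "\<lambda>pK. branching (fst pK) (snd pK)" "(p0, K0)" "\<lambda>pK. card (snd pK)"] by simp
  then obtain p K where br: "branching p K" and min: "\<And>p' K'. branching p' K' \<Longrightarrow> card K \<le> card K'"
    by (metis fst_conv snd_conv)
  have st: "search_state V E t p K" and two_nb: "2 \<le> card (nbrs E (hd p) \<inter> K)"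
    using br by (auto simp: branching_def)
  have finK: "finite K" using st finV finite_subset by (auto simp: search_state_def)
  obtain c x where c: "c \<in> nbrs E (hd p) \<inter> K" and x: "x \<in> nbrs E (hd p) \<inter> K" "x \<noteq> c"
    using two_elements[OF two_nb] by metis
  define U where "U = set (tl p)"
  have p: "set p = insert (hd p) U" "hd p \<notin> U"
    using st by (cases p; auto simp: U_def search_state_def)+
  have below: "search_state V E t (c # p) (component_of E (K - {c}) y)"
      "component_of E (K - {c}) y \<subseteq> K - {c}"
      "\<exists>l\<in>component_of E (K - {c}) y. \<exists>u\<in>U. {l, u} \<in> E"
      "card (nbrs E c \<inter> component_of E (K - {c}) y) \<le> 1"
    if y: "y \<in> K" "y \<noteq> c" for y
  proof -
    let ?K = "component_of E (K - {c}) y"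
    note step = search_step[OF st c y]
    show stK: "search_state V E t (c # p) ?K" by (rule step)
    show "?K \<subseteq> K - {c}" using y by (intro component_of_subset) auto
    have less: "card ?K < card K" using finK step(2) by (rule psubset_card_mono)
    have nb: "card (nbrs E (hd q) \<inter> L) \<le> 1" if "search_state V E t q L" "card L \<le> card ?K" for q L
      using min[of q L] that less by (force simp: branching_def)
    from nb[OF stK] show "card (nbrs E c \<inter> ?K) \<le> 1" by simp
    obtain l where l: "l \<in> ?K" "2 \<le> card (nbrs E l \<inter> set p)"
      using deep_vertex[OF G deg' stK] nb by auto
    obtain a b where "a \<in> nbrs E l \<inter> set p" "b \<in> nbrs E l \<inter> set p" "a \<noteq> b"
      using two_elements[OF l(2)] by metis
    with p have "\<exists>u\<in>U. {l, u} \<in> E" by (auto simp: in_nbrs_iff)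
    with l(1) show "\<exists>l\<in>?K. \<exists>u\<in>U. {l, u} \<in> E" by blast
  qed
  define K1 where "K1 = component_of E (K - {c}) x"
  note K1 = below[of x, folded K1_def]
  have xK: "x \<in> K" "x \<in> K1" using x by (auto simp: K1_def component_of_self)
  have U: "U \<noteq> {}" "U \<subseteq> V" "connected_in E U" "{hd p, hd (tl p)} \<in> E" "hd (tl p) \<in> U"
  proof -
    show "U \<noteq> {}" using K1(3) xK x by blast
    then obtain a b bs where ab: "p = a # b # bs"
      unfolding U_def by (metis empty_set list.exhaust list.sel(2,3))
    then have "is_walk E (b # bs)" "{a, b} \<in> E" "set p \<subseteq> V"
      using st by (auto simp: search_state_def)
    then show "U \<subseteq> V" "connected_in E U" "{hd p, hd (tl p)} \<in> E" "hd (tl p) \<in> U"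
      using connected_in_walk[of E "b # bs"] ab by (auto simp: U_def)
  qed
  have verts: "c \<in> V" "hd p \<in> V" "K \<subseteq> V" "c \<notin> U" "hd p \<noteq> c" "hd p \<notin> K" "K \<inter> U = {}" "c \<noteq> t"
    using st c p by (auto simp: search_state_def)
  have ends: "{c, hd p} \<in> E" "{hd p, x} \<in> E"
    using c x by (auto simp: in_nbrs_iff insert_commute)
  have conn: "connected_in E L" "\<exists>w\<in>L. {c, w} \<in> E" if "search_state V E t (c # p) L" for L
    using that by (auto simp: search_state_def in_nbrs_iff)
  show False
  proof (cases "\<exists>u\<in>U. {c, u} \<in> E")
    case True
    let ?X = "\<lambda>i. [{c}, {hd p}, K1, U] ! i"
    show False
    proof (rule no_K4_minor[OF M, of ?X])
      fix i :: nat assume "i < 4"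
      then have "i = 0 \<or> i = 1 \<or> i = 2 \<or> i = 3" by linarith
      then show "connected_in (edges M) (?X i) \<and> ?X i \<noteq> {} \<and> ?X i \<subseteq> verts M"
        using conn(1)[OF K1(1)] xK x U verts K1(2) unfolding V_def[symmetric] E_def[symmetric] by auto
    next
      fix i j :: nat assume ij: "i < 4" "j < 4" "i < j"
      then have ij: "i = 0 \<and> j = 1 \<or> i = 0 \<and> j = 2 \<or> i = 0 \<and> j = 3 \<or>
          i = 1 \<and> j = 2 \<or> i = 1 \<and> j = 3 \<or> i = 2 \<and> j = 3" by linarith
      then show "?X i \<inter> ?X j = {}"
        using verts K1(2) xK x p(2) by (elim disjE conjE) (simp_all; blast)+
      have "\<exists>w\<in>K1. {c, w} \<in> E" "\<exists>w\<in>K1. {hd p, w} \<in> E" "\<exists>u\<in>U. {hd p, u} \<in> E"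
          "\<exists>l\<in>K1. \<exists>u\<in>U. {l, u} \<in> E"
        using conn(2)[OF K1(1)] K1(3) U(4,5) xK x ends by blast+
      with True ends(1) ij show "\<exists>a\<in>?X i. \<exists>b\<in>?X j. {a, b} \<in> edges M"
        unfolding E_def[symmetric] by (elim disjE conjE) simp_all
    qed
  next
    case False
    have "\<exists>y\<in>nbrs E c. y \<in> K \<and> y \<notin> K1"
    proof (rule ccontr)
      assume none: "\<not> ?thesis"
      have "nbrs E c \<subseteq> K \<union> set p" using st c by (auto simp: search_state_def)
      with none False p have "nbrs E c \<subseteq> insert (hd p) (nbrs E c \<inter> K1)"
        by (auto simp: in_nbrs_iff)
      then have "card (nbrs E c) \<le> card (insert (hd p) (nbrs E c \<inter> K1))"
        using graph_nbrs(2)[OF G, of c] by (intro card_mono) auto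
      also have "\<dots> \<le> Suc (card (nbrs E c \<inter> K1))" by (rule card_insert_le_m1) auto
      finally show False using deg[of c] verts K1(4) xK x by force
    qed
    then obtain y where y: "y \<in> nbrs E c" "y \<in> K" "y \<notin> K1" by blast
    have "y \<noteq> c" using y graph_nbrs(3)[OF G] by blast
    define K2 where "K2 = component_of E (K - {c}) y"
    note K2 = below[OF \<open>y \<in> K\<close> \<open>y \<noteq> c\<close>, folded K2_def]
    have yK2: "y \<in> K2" by (simp add: K2_def component_of_self)
    have K12: "K1 \<inter> K2 = {}"
    proof (rule ccontr)
      assume "K1 \<inter> K2 \<noteq> {}"
      then obtain w where "(x, w) \<in> (step_in E (K - {c}))\<^sup>*" "(y, w) \<in> (step_in E (K - {c}))\<^sup>*"
        by (auto simp: K1_def K2_def component_of_def)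
      then have "(x, y) \<in> (step_in E (K - {c}))\<^sup>*"
        using step_in_rtrancl_sym rtrancl_trans by metis
      with y(3) show False by (simp add: K1_def component_of_def)
    qed
    let ?X = "\<lambda>i. [{c}, U, {hd p}, K1, K2] ! i"
    show False
    proof (rule no_K23_minor[OF M, of ?X])
      fix i :: nat assume "i < 5"
      then have "i = 0 \<or> i = 1 \<or> i = 2 \<or> i = 3 \<or> i = 4" by linarith
      then show "connected_in (edges M) (?X i) \<and> ?X i \<noteq> {} \<and> ?X i \<subseteq> verts M"
        using conn(1)[OF K1(1)] conn(1)[OF K2(1)] xK yK2 x U verts K1(2) K2(2)
        unfolding V_def[symmetric] E_def[symmetric] by auto
    next
      fix i j :: nat assume ij: "i < 5" "j < 5" "i < j"
      then have "i = 0 \<and> j = 1 \<or> i = 0 \<and> j = 2 \<or> i = 0 \<and> j = 3 \<or> i = 0 \<and> j = 4 \<or>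
          i = 1 \<and> j = 2 \<or> i = 1 \<and> j = 3 \<or> i = 1 \<and> j = 4 \<or> i = 2 \<and> j = 3 \<or> i = 2 \<and> j = 4 \<or> i = 3 \<and> j = 4"
        by presburger
      then show "?X i \<inter> ?X j = {}"
        using verts K1(2) K2(2) xK x K12 p(2) by (elim disjE conjE) (simp_all; blast)+
    next
      fix i j :: nat assume "i < 2" "2 \<le> j" "j < 5"
      then have ij: "(i = 0 \<or> i = 1) \<and> (j = 2 \<or> j = 3 \<or> j = 4)" by linarith
      have "\<exists>w\<in>K1. {c, w} \<in> E" "\<exists>w\<in>K2. {c, w} \<in> E" "\<exists>u\<in>U. {u, hd p} \<in> E"
          "\<exists>u\<in>U. \<exists>l\<in>K1. {u, l} \<in> E" "\<exists>u\<in>U. \<exists>l\<in>K2. {u, l} \<in> E"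
        using conn(2)[OF K1(1)] conn(2)[OF K2(1)] K1(3) K2(3) U(4,5) xK x by (metis insert_commute IntD2)+
      with ends(1) ij show "\<exists>a\<in>?X i. \<exists>b\<in>?X j. {a, b} \<in> edges M"
        unfolding E_def[symmetric] by (elim disjE conjE) simp_all
    qed
  qed
qed

section \<open>Suppressing a vertex of degree at most two\<close>

text \<open>The neighbours of \<open>v\<close> become pairwise adjacent. For degree at most 2 this adds at most one edge, so that
  deleting a pendant vertex and smoothing a vertex of degree 2 are the same operation.\<close>

definition suppress :: "'a set set \<Rightarrow> 'a \<Rightarrow> 'a set set" where
  "suppress E v = {e \<in> E. v \<notin> e} \<union> {{a, b} | a b. a \<in> nbrs E v \<and> b \<in> nbrs E v \<and> a \<noteq> b}"

text \<open>Removing parts of a drawing enlarges the outer face, so that the remaining vertices stay on its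
  frontier.\<close>

lemma outerplanar_subdrawing:
  assumes M: "outerplanar_map M" and M': "planar_map M'"
    and sub: "verts M' \<subseteq> verts M" "drawing M' \<subseteq> drawing M"
  shows "outerplanar_map M'"
  unfolding outerplanar_map_def
proof (intro conjI ballI M')
  fix v assume v: "v \<in> verts M'"
  then have "v \<in> closure (outside (drawing M))"
    using M sub by (auto simp: outerplanar_map_def on_outer_face_def outer_face_def frontier_def)
  then have "v \<in> closure (outside (drawing M'))"
    using closure_mono[OF outside_mono[OF sub(2)]] by blast
  moreover have "v \<notin> outside (drawing M')"
    using v outside_no_overlap[of "drawing M'"] unfolding drawing_def by blast
  ultimately have "v \<in> frontier (outside (drawing M'))"
    using interior_subset by (auto simp: frontier_def)
  with v show "on_outer_face M' v"
    by (simp add: on_outer_face_def outer_face_def)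
qed

text \<open>If an edge has to be added, it is drawn along the two old edges through \<open>v\<close>.\<close>

lemma suppress_outerplanar:
  assumes M: "outerplanar_map M" and v: "v \<in> verts M" and deg: "card (nbrs (edges M) v) \<le> 2"
  shows "\<exists>M'. outerplanar_map M' \<and> verts M' = verts M - {v} \<and> edges M' = suppress (edges M) v"
proof -
  let ?E = "edges M"
  note G = outerplanar_graph[OF M]
  have pm: "planar_map M" using M by (simp add: outerplanar_map_def)
  have fin: "finite (verts M)"
    and edge: "\<And>e. e \<in> ?E \<Longrightarrow> e \<subseteq> verts M \<and> card e = 2 \<and> arc (curve M e) \<and>
        {pathstart (curve M e), pathfinish (curve M e)} = e \<and> path_image (curve M e) \<inter> verts M = e"
    and meet: "\<And>e f. e \<in> ?E \<Longrightarrow> f \<in> ?E \<Longrightarrow> e \<noteq> f \<Longrightarrow>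
        path_image (curve M e) \<inter> path_image (curve M f) = e \<inter> f"
    using pm by (auto simp: planar_map_def)
  show ?thesis
  proof (cases "\<exists>a b. nbrs ?E v = {a, b} \<and> a \<noteq> b \<and> {a, b} \<notin> ?E")
    case False
    have "suppress ?E v = {e \<in> ?E. v \<notin> e}"
    proof -
      have "{a, b} \<in> ?E \<and> v \<notin> {a, b}" if ab: "a \<in> nbrs ?E v" "b \<in> nbrs ?E v" "a \<noteq> b" for a b
      proof -
        have "{a, b} \<subseteq> nbrs ?E v" "card {a, b} = 2" using ab by auto
        then have "nbrs ?E v = {a, b}"
          using deg graph_nbrs(2)[OF G, of v] by (metis card_seteq)
        with False ab graph_nbrs(3)[OF G, of v] show ?thesis by auto
      qed
      then show ?thesis by (auto simp: suppress_def)
    qed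
    moreover define M' where "M' = M\<lparr>verts := verts M - {v}, edges := {e \<in> ?E. v \<notin> e}\<rparr>"
    moreover have "planar_map M'"
      using fin edge meet by (auto simp: planar_map_def M'_def)
    moreover have "drawing M' \<subseteq> drawing M" "verts M' \<subseteq> verts M" by (auto simp: drawing_def M'_def)
    ultimately show ?thesis
      using outerplanar_subdrawing[OF M, of M'] by (intro exI[of _ M']) auto
  next
    case True
    then obtain a b where ab: "nbrs ?E v = {a, b}" "a \<noteq> b" "{a, b} \<notin> ?E" by blast
    then have e: "{a, v} \<in> ?E" "{v, b} \<in> ?E" and ne: "a \<noteq> v" "b \<noteq> v" "{a, v} \<noteq> {v, b}"
      using graph_nbrs(3)[OF G, of v] by (auto simp: nbrs_def insert_commute set_eq_iff doubleton_eq_iff)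
    obtain g1 where g1: "arc_between a v g1" "path_image g1 = path_image (curve M {a, v})"
      using edge_curve[OF pm e(1)] by metis
    obtain g2 where g2: "arc_between v b g2" "path_image g2 = path_image (curve M {v, b})"
      using edge_curve[OF pm e(2)] by metis
    define g where "g = g1 +++ g2"
    have "path_image g1 \<inter> path_image g2 \<subseteq> {v}"
      using meet[OF e ne(3)] ab(2) ne g1 g2 by auto
    then have g: "arc_between a b g" "path_image g = path_image (curve M {a, v}) \<union> path_image (curve M {v, b})"
      using arc_between_join[OF g1(1) g2(1)] by (simp_all add: g_def g1 g2)
    have sup: "suppress ?E v = insert {a, b} {e \<in> ?E. v \<notin> e}"
      using ab by (auto simp: suppress_def insert_commute)
    have g_verts: "path_image g \<inter> (verts M - {v}) = {a, b}"
    proof -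
      have "path_image (curve M {a, v}) \<inter> verts M = {a, v}" "path_image (curve M {v, b}) \<inter> verts M = {v, b}"
        using edge e by blast+
      then have "path_image g \<inter> verts M = {a, v} \<union> {v, b}" unfolding g(2) by (simp only: Int_Un_distrib2)
      with ne show ?thesis by blast
    qed
    have g_meet: "path_image g \<inter> path_image (curve M f) = {a, b} \<inter> f" if "f \<in> ?E" "v \<notin> f" for f
    proof -
      have "f \<noteq> {a, v}" "f \<noteq> {v, b}" using that(2) by auto
      with meet[OF e(1) that(1)] meet[OF e(2) that(1)] that(2) show ?thesis
        unfolding g(2) by blast
    qed
    define M' where "M' = M\<lparr>verts := verts M - {v}, edges := suppress ?E v, curve := (curve M)({a, b} := g)\<rparr>"
    have sel: "verts M' = verts M - {v}" "edges M' = insert {a, b} {e \<in> ?E. v \<notin> e}"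
       "curve M' {a, b} = g" "\<And>f. f \<in> ?E \<Longrightarrow> curve M' f = curve M f"
      using ab(3) sup by (auto simp: M'_def)
    have ab_verts: "{a, b} \<subseteq> verts M - {v}"
      using edge[OF e(1)] edge[OF e(2)] ne by auto
    have pm': "planar_map M'"
      unfolding planar_map_def sel(1,2)
    proof (intro conjI ballI impI)
      show "finite (verts M - {v})" using fin by simp
    next
      fix f assume "f \<in> insert {a, b} {e \<in> ?E. v \<notin> e}"
      then consider "f = {a, b}" | "f \<in> ?E" "v \<notin> f" by blast
      then have "f \<subseteq> verts M - {v} \<and> card f = 2 \<and> arc (curve M' f) \<and>
        {pathstart (curve M' f), pathfinish (curve M' f)} = f \<and> path_image (curve M' f) \<inter> (verts M - {v}) = f"
      proof cases
        case 1
        then show ?thesis using g(1) g_verts ab_verts ab(2) by (simp add: sel(3) arc_between_def)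
      next
        case 2
        then show ?thesis using edge[OF 2(1)] sel(4)[OF 2(1)] by auto
      qed
      then show "f \<subseteq> verts M - {v}" "card f = 2" "arc (curve M' f)"
        "{pathstart (curve M' f), pathfinish (curve M' f)} = f" "path_image (curve M' f) \<inter> (verts M - {v}) = f"
        by (simp_all only:)
    next
      fix f h assume "f \<in> insert {a, b} {e \<in> ?E. v \<notin> e}" "h \<in> insert {a, b} {e \<in> ?E. v \<notin> e}" "f \<noteq> h"
      then consider "f = {a, b}" "h \<in> ?E" "v \<notin> h" | "h = {a, b}" "f \<in> ?E" "v \<notin> f"
        | "f \<in> ?E" "h \<in> ?E" by blast
      then show "path_image (curve M' f) \<inter> path_image (curve M' h) = f \<inter> h"
      proof cases
        case 1
        then show ?thesis using g_meet by (simp add: sel)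
      next
        case 2
        then show ?thesis using g_meet[of f] by (simp add: sel Int_commute)
      next
        case 3
        then show ?thesis using meet \<open>f \<noteq> h\<close> by (simp add: sel)
      qed
    qed
    have "drawing M' \<subseteq> drawing M"
      using e unfolding drawing_def sel(1,2) by (auto simp: sel(3,4) g(2))
    then have "outerplanar_map M'"
      using outerplanar_subdrawing[OF M pm'] sel(1) by auto
    then show ?thesis using sel(1,2) sup by (intro exI[of _ M']) auto
  qed
qed


section \<open>Bipolar orientations under suppression\<close>

text \<open>The counting argument concerns the graph alone, so it is carried out for a vertex set and an edge
  set without a drawing.\<close>

definition bipolar :: "'a set \<Rightarrow> 'a set set \<Rightarrow> 'a \<Rightarrow> 'a \<Rightarrow> ('a \<times> 'a) set set" where
  "bipolar V E s t = {D.
     (\<forall>(u, v)\<in>D. {u, v} \<in> E) \<and> (\<forall>u v. {u, v} \<in> E \<longrightarrow> ((u, v) \<in> D \<longleftrightarrow> (v, u) \<notin> D)) \<and> acyclic D \<and>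
     {v \<in> V. \<nexists>u. (u, v) \<in> D} = {s} \<and> {v \<in> V. \<nexists>w. (v, w) \<in> D} = {t}}"

lemma bipolar_orientations_eq: "bipolar_orientations M s t = bipolar (verts M) (edges M) s t"
  by (simp add: bipolar_orientations_def bipolar_orientation_def orientation_def bipolar_def conj_assoc)

lemma bipolarI:
  assumes "\<And>u v. (u, v) \<in> D \<Longrightarrow> {u, v} \<in> E"
    and "\<And>u v. {u, v} \<in> E \<Longrightarrow> (u, v) \<in> D \<or> (v, u) \<in> D"
    and "acyclic D" "s \<in> V" "t \<in> V"
    and "\<And>u. (u, s) \<notin> D" "\<And>w. (t, w) \<notin> D"
    and "\<And>v. v \<in> V \<Longrightarrow> v \<noteq> s \<Longrightarrow> \<exists>u. (u, v) \<in> D"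
    and "\<And>v. v \<in> V \<Longrightarrow> v \<noteq> t \<Longrightarrow> \<exists>w. (v, w) \<in> D"
  shows "D \<in> bipolar V E s t"
proof -
  have "(v, u) \<notin> D" if "(u, v) \<in> D" for u v
    using \<open>acyclic D\<close> that by (meson acyclic_def r_into_trancl trancl_trans)
  then have "\<forall>u v. {u, v} \<in> E \<longrightarrow> ((u, v) \<in> D \<longleftrightarrow> (v, u) \<notin> D)"
    using assms(2) by blast
  moreover have "{v \<in> V. \<nexists>u. (u, v) \<in> D} = {s}" "{v \<in> V. \<nexists>w. (v, w) \<in> D} = {t}"
    using assms by blast+
  ultimately show ?thesis
    using assms(1,3) by (auto simp: bipolar_def)
qed

lemma bipolarD:
  assumes "D \<in> bipolar V E s t"
  shows "\<And>u v. (u, v) \<in> D \<Longrightarrow> {u, v} \<in> E"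
    and "\<And>u v. {u, v} \<in> E \<Longrightarrow> (u, v) \<in> D \<or> (v, u) \<in> D"
    and "\<And>u v. (u, v) \<in> D \<Longrightarrow> (v, u) \<notin> D"
    and "acyclic D" "s \<in> V" "t \<in> V"
    and "\<And>u. (u, s) \<notin> D" "\<And>w. (t, w) \<notin> D"
    and "\<And>v. v \<in> V \<Longrightarrow> v \<noteq> s \<Longrightarrow> \<exists>u. (u, v) \<in> D"
    and "\<And>v. v \<in> V \<Longrightarrow> v \<noteq> t \<Longrightarrow> \<exists>w. (v, w) \<in> D"
proof -
  have D: "\<forall>(u, v)\<in>D. {u, v} \<in> E" "\<forall>u v. {u, v} \<in> E \<longrightarrow> ((u, v) \<in> D \<longleftrightarrow> (v, u) \<notin> D)" "acyclic D"
    "{v \<in> V. \<nexists>u. (u, v) \<in> D} = {s}" "{v \<in> V. \<nexists>w. (v, w) \<in> D} = {t}"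
    using assms by (auto simp: bipolar_def)
  then show "\<And>u v. (u, v) \<in> D \<Longrightarrow> {u, v} \<in> E" "\<And>u v. {u, v} \<in> E \<Longrightarrow> (u, v) \<in> D \<or> (v, u) \<in> D"
    "\<And>u v. (u, v) \<in> D \<Longrightarrow> (v, u) \<notin> D" "acyclic D" by blast+
  show "s \<in> V" "\<And>u. (u, s) \<notin> D" "\<And>v. v \<in> V \<Longrightarrow> v \<noteq> s \<Longrightarrow> \<exists>u. (u, v) \<in> D"
    using D(4) by blast+
  show "t \<in> V" "\<And>w. (t, w) \<notin> D" "\<And>v. v \<in> V \<Longrightarrow> v \<noteq> t \<Longrightarrow> \<exists>w. (v, w) \<in> D"
    using D(5) by blast+
qed

lemma bipolar_subset:
  assumes "graph V E" "D \<in> bipolar V E s t"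
  shows "D \<subseteq> V \<times> V"
proof
  fix p assume "p \<in> D"
  then have "{fst p, snd p} \<in> E" using bipolarD(1)[OF assms(2), of "fst p" "snd p"] by simp
  then show "p \<in> V \<times> V" using assms(1) by (cases p) (auto simp: graph_def)
qed

lemma finite_bipolar: "graph V E \<Longrightarrow> finite (bipolar V E s t)"
  using bipolar_subset[of V E _ s t]
  by (intro finite_subset[of "bipolar V E s t" "Pow (V \<times> V)"]) (auto simp: graph_def)

lemma bipolar_minimal:
  assumes G: "graph V E" and D: "D \<in> bipolar V E s t" and W: "W \<subseteq> V" "W \<noteq> {}"
  obtains a where "a \<in> W" "\<And>y. (y, a) \<in> D \<Longrightarrow> y \<in> V - W"
proof -
  have sub: "D \<subseteq> V \<times> V" using bipolar_subset[OF G D] .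
  then have "finite D" using G finite_subset by (fastforce simp: graph_def)
  then have "wf D" using bipolarD(4)[OF D] finite_acyclic_wf by blast
  then obtain a where "a \<in> W" "\<And>y. (y, a) \<in> D \<Longrightarrow> y \<notin> W"
    using W(2) by (metis ex_in_conv wfE_min)
  with sub that show thesis by blast
qed

text \<open>By acyclicity, some vertex other than \<open>t\<close> has no predecessor except \<open>t\<close>, but no edge leaves \<open>t\<close>.\<close>

lemma bipolar_same_ends:
  assumes G: "graph V E" and "2 \<le> card V"
  shows "bipolar V E t t = {}"
proof (rule ccontr)
  assume "bipolar V E t t \<noteq> {}"
  then obtain D where D: "D \<in> bipolar V E t t" by blast
  have "V - {t} \<noteq> {}"
    using two_elements[OF assms(2)] by (metis Diff_eq_empty_iff singletonD subsetD)
  then obtain a where a: "a \<in> V - {t}" "\<And>y. (y, a) \<in> D \<Longrightarrow> y \<in> V - (V - {t})"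
    using bipolar_minimal[OF G D, of "V - {t}"] by blast
  obtain y where y: "(y, a) \<in> D" using bipolarD(9)[OF D, of a] a(1) by blast
  with a(2) have "y = t" by blast
  with y bipolarD(8)[OF D] show False by blast
qed

text \<open>At an inner vertex of degree two, one edge enters and the other leaves, so replacing the two
  edges by a shortcut loses no information.\<close>

lemma card_bipolar_suppress_inner:
  assumes G: "graph V E" and v: "v \<in> V" "v \<noteq> s" "v \<noteq> t" and deg: "card (nbrs E v) \<le> 2"
    and fin: "finite (bipolar (V - {v}) (suppress E v) s t)"
  shows "card (bipolar V E s t) \<le> card (bipolar (V - {v}) (suppress E v) s t)"
proof -
  let ?N = "nbrs E v"
  \<comment> \<open>The map \<open>g\<close> recovers an orientation from its image: the orientation of the shortcut tells in
    which direction \<open>v\<close> is passed.\<close>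
  define g where "g D' = {(x, y) \<in> D'. {x, y} \<in> E} \<union> {(x, v) | x. x \<in> ?N \<and> (\<exists>y\<in>?N. (x, y) \<in> D')} \<union>
      {(v, y) | y. y \<in> ?N \<and> (\<exists>x\<in>?N. (x, y) \<in> D')}" for D' :: "('a \<times> 'a) set"
  have "D \<in> g ` bipolar (V - {v}) (suppress E v) s t" if D: "D \<in> bipolar V E s t" for D
  proof -
    note B = bipolarD[OF D]
    obtain a b where ab: "(a, v) \<in> D" "(v, b) \<in> D" using B(9,10) v by blast
    then have N_sub: "{a, b} \<subseteq> ?N" and "a \<noteq> b"
      using B(1)[of a v] B(1)[of v b] B(3) by (auto simp: in_nbrs_iff insert_commute)
    then have N: "?N = {a, b}"
      using deg graph_nbrs(2)[OF G, of v] card_seteq[of ?N "{a, b}"] by simp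
    have ne: "a \<noteq> v" "b \<noteq> v" using N graph_nbrs(3)[OF G, of v] by auto
    have ba: "(b, a) \<notin> D"
    proof
      assume "(b, a) \<in> D"
      with ab have "(a, a) \<in> D\<^sup>+" by (meson r_into_trancl trancl_into_trancl)
      with B(4) show False by (simp add: acyclic_def)
    qed
    have at_v: "x = a" if "(x, v) \<in> D" for x
    proof -
      have "x \<in> ?N" using B(1)[OF that] by (simp add: in_nbrs_iff insert_commute)
      with N B(3)[OF that] ab(2) show ?thesis by auto
    qed
    have from_v: "y = b" if "(v, y) \<in> D" for y
    proof -
      have "y \<in> ?N" using B(1)[OF that] by (simp add: in_nbrs_iff)
      with N B(3)[OF that] ab(1) show ?thesis by auto
    qed
    define D' where "D' = {(x, y) \<in> D. x \<noteq> v \<and> y \<noteq> v} \<union> {(a, b)}"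
    have D'_iff: "(x, y) \<in> D' \<longleftrightarrow> (x, y) \<in> D \<and> x \<noteq> v \<and> y \<noteq> v \<or> x = a \<and> y = b" for x y
      by (auto simp: D'_def)
    have sup: "{x, y} \<in> suppress E v \<longleftrightarrow>
        {x, y} \<in> E \<and> x \<noteq> v \<and> y \<noteq> v \<or> x = a \<and> y = b \<or> x = b \<and> y = a" for x y
      using \<open>a \<noteq> b\<close> unfolding suppress_def N by (auto simp: doubleton_eq_iff)
    have "D' \<in> bipolar (V - {v}) (suppress E v) s t"
    proof (rule bipolarI)
      show "{x, y} \<in> suppress E v" if "(x, y) \<in> D'" for x y
        using that B(1) by (auto simp: D'_iff sup)
      show "(x, y) \<in> D' \<or> (y, x) \<in> D'" if "{x, y} \<in> suppress E v" for x y
        using that B(2) by (auto simp: D'_iff sup)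
      have step: "(x, y) \<in> D\<^sup>+" if "(x, y) \<in> D'" for x y
        using that ab by (auto simp: D'_iff intro: trancl_into_trancl)
      have "(x, y) \<in> D\<^sup>+" if "(x, y) \<in> D'\<^sup>+" for x y
        using that by (induction rule: trancl_induct) (use step trancl_trans in metis)+
      with B(4) show "acyclic D'" by (auto simp: acyclic_def)
      show "s \<in> V - {v}" "t \<in> V - {v}" using B v by auto
      show "(u, s) \<notin> D'" for u using B(7) ab by (auto simp: D'_iff)
      show "(t, w) \<notin> D'" for w using B(8) ab by (auto simp: D'_iff)
      show "\<exists>u. (u, x) \<in> D'" if "x \<in> V - {v}" "x \<noteq> s" for x
        using B(9)[of x] that from_v by (auto simp: D'_iff)
      show "\<exists>w. (x, w) \<in> D'" if "x \<in> V - {v}" "x \<noteq> t" for x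
        using B(10)[of x] that at_v by (auto simp: D'_iff)
    qed
    moreover have "(x, y) \<in> g D' \<longleftrightarrow> (x, y) \<in> D" for x y
    proof -
      have abE: "(a, b) \<in> D" if "{a, b} \<in> E" using B(2)[OF that] ba by blast
      have "(a, b) \<in> D'" "(b, a) \<notin> D'" "(a, a) \<notin> D'" "(b, b) \<notin> D'"
        using ba \<open>a \<noteq> b\<close> B(3)[of a a] B(3)[of b b] by (auto simp: D'_iff)
      then have "(x, y) \<in> g D' \<longleftrightarrow> (x, y) \<in> D' \<and> {x, y} \<in> E \<or> y = v \<and> x = a \<or> x = v \<and> y = b"
        unfolding g_def N by auto
      also have "\<dots> \<longleftrightarrow> (x, y) \<in> D"
      proof
        assume "(x, y) \<in> D' \<and> {x, y} \<in> E \<or> y = v \<and> x = a \<or> x = v \<and> y = b"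
        then show "(x, y) \<in> D" using ab abE by (auto simp: D'_iff)
      next
        assume "(x, y) \<in> D"
        then show "(x, y) \<in> D' \<and> {x, y} \<in> E \<or> y = v \<and> x = a \<or> x = v \<and> y = b"
          using at_v from_v B(1)[of x y] by (auto simp: D'_iff)
      qed
      finally show ?thesis .
    qed
    then have "g D' = D" by auto
    ultimately show ?thesis by blast
  qed
  then show ?thesis by (intro surj_card_le[OF fin]) blast
qed

text \<open>Once the source is deleted, some vertex \<open>a \<noteq> t\<close> has no predecessor left. It must be a neighbour
  of the old source and becomes the new one. The edge from \<open>a\<close> to the other neighbour of the old
  source gives that neighbour a predecessor in case it has lost its only one.\<close>

lemma card_bipolar_suppress_source:
  assumes G: "graph V E" and st: "s \<noteq> t" and V: "3 \<le> card V" and deg: "card (nbrs E s) \<le> 2"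
    and fin: "\<And>a. finite (bipolar (V - {s}) (suppress E s) a t)"
  shows "card (bipolar V E s t) \<le> (\<Sum>a\<in>nbrs E s. card (bipolar (V - {s}) (suppress E s) a t))"
proof -
  let ?N = "nbrs E s" and ?B = "\<lambda>a. bipolar (V - {s}) (suppress E s) a t"
  \<comment> \<open>The first component of \<open>p\<close>, the new source, only keeps the orientations for different sources apart.\<close>
  define g where "g p = {(x, y) \<in> snd p. {x, y} \<in> E} \<union> {s} \<times> ?N" for p :: "'a \<times> ('a \<times> 'a) set"
  have "D \<in> g ` (SIGMA a:?N. ?B a)" if D: "D \<in> bipolar V E s t" for D
  proof -
    note B = bipolarD[OF D]
    have "V - {s, t} \<noteq> {}"
    proof
      assume "V - {s, t} = {}"
      then have "card V \<le> card {s, t}" by (intro card_mono) auto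
      with V st show False by simp
    qed
    then obtain a where a: "a \<in> V - {s, t}" "\<And>y. (y, a) \<in> D \<Longrightarrow> y \<in> V - (V - {s, t})"
      using bipolar_minimal[OF G D, of "V - {s, t}"] by blast
    have in_a: "y = s" if "(y, a) \<in> D" for y
      using a(2)[OF that] that B(8) by blast
    obtain y where "(y, a) \<in> D" using B(9)[of a] a(1) by blast
    then have sa: "(s, a) \<in> D" using in_a by blast
    then have aN: "a \<in> ?N" using B(1) by (auto simp: in_nbrs_iff)
    have sN: "s \<notin> ?N" using graph_nbrs(3)[OF G] .
    have out_s: "(s, y) \<in> D \<longleftrightarrow> y \<in> ?N" for y
      using B(1)[of s y] B(2)[of s y] B(7)[of y] by (auto simp: in_nbrs_iff)
    have N: "x = a \<or> y = a" if "x \<in> ?N" "y \<in> ?N" "x \<noteq> y" for x y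
    proof (rule ccontr)
      assume "\<not> ?thesis"
      then have "card {a, x, y} = 3" using that(3) by auto
      moreover have "card {a, x, y} \<le> card ?N"
        using that aN graph_nbrs(2)[OF G, of s] by (intro card_mono) auto
      ultimately show False using deg by linarith
    qed
    define D' where "D' = {(x, y) \<in> D. x \<noteq> s} \<union> {a} \<times> (?N - {a})"
    have D'_iff: "(x, y) \<in> D' \<longleftrightarrow> (x, y) \<in> D \<and> x \<noteq> s \<or> x = a \<and> y \<in> ?N \<and> y \<noteq> a" for x y
      by (auto simp: D'_def)
    have sup: "{x, y} \<in> suppress E s \<longleftrightarrow> {x, y} \<in> E \<and> x \<noteq> s \<and> y \<noteq> s \<or> x \<in> ?N \<and> y \<in> ?N \<and> x \<noteq> y" for x y
      unfolding suppress_def by (auto simp: doubleton_eq_iff)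
    have no_in_a: "(y, a) \<notin> D'" for y
      using in_a by (auto simp: D'_iff)
    have "D' \<in> ?B a"
    proof (rule bipolarI)
      show "{x, y} \<in> suppress E s" if "(x, y) \<in> D'" for x y
        using that B(1) B(7) aN by (auto simp: D'_iff sup)
      show "(x, y) \<in> D' \<or> (y, x) \<in> D'" if "{x, y} \<in> suppress E s" for x y
        using that B(2)[of x y] N[of x y] by (auto simp: D'_iff sup)
      have below: "y \<noteq> a \<and> (x, y) \<in> D\<^sup>+" if "(x, y) \<in> D'\<^sup>+" "x \<noteq> a" for x y
        using that
      proof (induction rule: trancl_induct)
        case (base y)
        with no_in_a show ?case by (auto simp: D'_iff)
      next
        case (step y z)
        then have "(y, z) \<in> D" by (auto simp: D'_iff)
        with step no_in_a show ?case by (metis trancl_into_trancl)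
      qed
      show "acyclic D'"
        unfolding acyclic_def
      proof (intro allI notI)
        fix x assume x: "(x, x) \<in> D'\<^sup>+"
        show False
        proof (cases "x = a")
          case True
          with x no_in_a show False by (metis tranclD2)
        next
          case False
          with below[OF x] B(4) show False by (auto simp: acyclic_def)
        qed
      qed
      show "a \<in> V - {s}" using a by blast
      show "t \<in> V - {s}" using B(6) st by blast
      show "(u, a) \<notin> D'" for u by (rule no_in_a)
      show "(t, w) \<notin> D'" for w using B(8) a(1) by (auto simp: D'_iff)
      show "\<exists>u. (u, x) \<in> D'" if "x \<in> V - {s}" "x \<noteq> a" for x
        using B(9)[of x] that out_s by (auto simp: D'_iff)
      show "\<exists>w. (x, w) \<in> D'" if "x \<in> V - {s}" "x \<noteq> t" for x
        using B(10)[of x] that by (auto simp: D'_iff)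
    qed
    moreover have "(x, y) \<in> g (a, D') \<longleftrightarrow> (x, y) \<in> D" for x y
    proof -
      have "(a, y) \<in> D" if "{a, y} \<in> E" "y \<in> ?N" for y
        using B(2)[OF that(1)] in_a that(2) sN by blast
      then show ?thesis
        using out_s[of y] B(1) a(1) sN unfolding g_def by (auto simp: D'_iff)
    qed
    then have "g (a, D') = D" by auto
    ultimately show ?thesis using aN by (intro image_eqI[of _ _ "(a, D')"]) auto
  qed
  then have "card (bipolar V E s t) \<le> card (SIGMA a:?N. ?B a)"
    using fin graph_nbrs(2)[OF G] by (intro surj_card_le[of _ _ g]) auto
  also have "\<dots> = (\<Sum>a\<in>?N. card (?B a))"
    using fin graph_nbrs(2)[OF G] by (intro card_SigmaI) auto
  finally show ?thesis .
qed

section \<open>The upper bound\<close>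

text \<open>Suppressing a vertex of degree at most 2 other than \<open>s\<close> and \<open>t\<close> does not decrease the number of
  orientations, so it remains to treat maps whose only such vertices are \<open>s\<close> and possibly \<open>t\<close>. Then \<open>s\<close> is
  suppressed, and one of its neighbours \<open>v\<close> and \<open>w\<close> becomes the source. The degrees of the other vertices are
  unchanged, so in the new map one of the two neighbours, say \<open>v\<close>, has degree at most 2. If \<open>w\<close> is the source,
  then \<open>v\<close> can be suppressed as well. This gives the recursion
  \<open>F\<^sub>n\<^sub>-\<^sub>1 = F\<^sub>n\<^sub>-\<^sub>2 + F\<^sub>n\<^sub>-\<^sub>3\<close>.\<close>

theorem card_bipolar_le_fib:
  assumes "outerplanar_map M" "s \<in> verts M" "t \<in> verts M" "s \<noteq> t"
  shows "card (bipolar (verts M) (edges M) s t) \<le> fib (card (verts M) - 1)"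
  using assms
proof (induction "card (verts M)" arbitrary: M s t rule: less_induct)
  case less
  note M = less.prems(1)
  define V E n where "V = verts M" and "E = edges M" and "n = card V"
  note G = outerplanar_graph[OF M, folded V_def E_def]
  have finV: "finite V" using G by (simp add: graph_def)
  have stV: "s \<in> V" "t \<in> V" "s \<noteq> t" using less.prems by (auto simp: V_def)
  then have "card {s, t} \<le> card V" using finV by (intro card_mono) auto
  with stV have n2: "2 \<le> n" by (simp add: n_def)
  show ?case
    unfolding V_def[symmetric] E_def[symmetric] n_def[symmetric]
  proof (cases "n = 2")
    case True
    then have Vst: "V = {s, t}"
      using card_seteq[OF finV, of "{s, t}"] stV by (simp add: n_def)
    have "bipolar V E s t \<subseteq> {{(s, t)}}"
    proof
      fix D assume D: "D \<in> bipolar V E s t"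
      note B = bipolarD[OF D]
      have sub: "D \<subseteq> {(s, t)}"
        using bipolar_subset[OF G D] B(7,8) unfolding Vst by auto
      moreover have "D \<noteq> {}" using B(9)[of t] stV by auto
      ultimately show "D \<in> {{(s, t)}}" by blast
    qed
    then have "card (bipolar V E s t) \<le> card {{(s, t)}}" by (intro card_mono) auto
    with True show "card (bipolar V E s t) \<le> fib (n - 1)" by simp
  next
    case False
    with n2 have n3: "3 \<le> n" by linarith
    show "card (bipolar V E s t) \<le> fib (n - 1)"
    proof (cases "\<exists>v\<in>V. v \<noteq> s \<and> v \<noteq> t \<and> card (nbrs E v) \<le> 2")
      case True
      then obtain v where v: "v \<in> V" "v \<noteq> s" "v \<noteq> t" "card (nbrs E v) \<le> 2" by blast
      obtain M' where M': "outerplanar_map M'" "verts M' = V - {v}" "edges M' = suppress E v"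
        using suppress_outerplanar[OF M] v unfolding V_def E_def by blast
      have card': "card (V - {v}) = n - 1" using v finV by (simp add: n_def)
      have "card (bipolar V E s t) \<le> card (bipolar (V - {v}) (suppress E v) s t)"
        using card_bipolar_suppress_inner[OF G v] finite_bipolar outerplanar_graph[OF M'(1)] M'(2,3) by metis
      also have "\<dots> \<le> fib (n - 1 - 1)"
        using less.hyps[of M' s t] M' stV v card' n3 by (simp add: V_def[symmetric] n_def[symmetric])
      also have "\<dots> \<le> fib (n - 1)" by (rule fib_mono) simp
      finally show ?thesis .
    next
      case no_inner: False
      obtain s' where "s' \<in> V" "s' \<noteq> t" "card (nbrs E s') \<le> 2"
        using low_degree_vertex[OF M less.prems(3)] n2 unfolding V_def E_def n_def by blast
      with no_inner have deg_s: "card (nbrs E s) \<le> 2" by metis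
      obtain M' where M': "outerplanar_map M'" "verts M' = V - {s}" "edges M' = suppress E s"
        using suppress_outerplanar[OF M] stV deg_s unfolding V_def E_def by blast
      note G' = outerplanar_graph[OF M'(1), unfolded M'(2,3)]
      have card': "card (V - {s}) = n - 1" using stV finV by (simp add: n_def)
      let ?f = "\<lambda>a. card (bipolar (V - {s}) (suppress E s) a t)"
      have N: "nbrs E s \<subseteq> V - {s}" "finite (nbrs E s)" using graph_nbrs[OF G, of s] by auto
      have sum: "card (bipolar V E s t) \<le> (\<Sum>a\<in>nbrs E s. ?f a)"
        using card_bipolar_suppress_source[OF G stV(3) _ deg_s finite_bipolar[OF G']] n3 by (simp add: n_def)
      have ft: "?f t = 0" using bipolar_same_ends[OF G'] card' n3 by simp
      have f_le: "?f a \<le> fib (n - 2)" if "a \<in> nbrs E s" for a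
      proof (cases "a = t")
        case True
        with ft show ?thesis by simp
      next
        case False
        then show ?thesis
          using less.hyps[of M' a t] M' stV N(1) card' n3 that
          by (auto simp: V_def[symmetric] n_def[symmetric] numeral_2_eq_2)
      qed
      show ?thesis
      proof (cases "card (nbrs E s - {t}) \<le> 1")
        case True
        have "(\<Sum>a\<in>nbrs E s. ?f a) = (\<Sum>a\<in>nbrs E s - {t}. ?f a)"
          using N ft by (intro sum.mono_neutral_right) auto
        also have "\<dots> \<le> of_nat (card (nbrs E s - {t})) * fib (n - 2)"
          using f_le by (intro sum_bounded_above) auto
        also have "\<dots> \<le> 1 * fib (n - 2)" using True by (intro mult_right_mono) auto
        also have "\<dots> \<le> fib (n - 1)" by (simp add: fib_mono)
        finally show ?thesis using sum by linarith
      next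
        case False
        then have "2 \<le> card (nbrs E s - {t})" by simp
        moreover have "card (nbrs E s - {t}) \<le> card (nbrs E s)" using N by (intro card_mono) auto
        ultimately have cN: "card (nbrs E s) = 2" "card (nbrs E s - {t}) = card (nbrs E s)"
          using deg_s by linarith+
        then have tN: "t \<notin> nbrs E s"
          using N(2) by (metis card_Diff1_less less_irrefl)
        \<comment> \<open>Needed for the last step of the recursion, which removes two vertices and leaves \<open>w\<close> and \<open>t\<close>.\<close>
        have n4: "4 \<le> n"
        proof -
          have "card ({s, t} \<union> nbrs E s) = 4"
            using stV N tN cN by (subst card_Un_disjoint) auto
          moreover have "card ({s, t} \<union> nbrs E s) \<le> n"
            unfolding n_def using stV N finV by (intro card_mono) auto
          ultimately show ?thesis by simp
        qed
        have "2 \<le> card (verts M')" "t \<in> verts M'" using M' card' n3 stV by auto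
        then obtain v where v: "v \<in> V - {s}" "v \<noteq> t" "card (nbrs (suppress E s) v) \<le> 2"
          using low_degree_vertex[OF M'(1), of t] M' by auto
        have vN: "v \<in> nbrs E s"
        proof (rule ccontr)
          assume "v \<notin> nbrs E s"
          then have "nbrs (suppress E s) v = nbrs E v"
            using v(1) by (auto simp: nbrs_def suppress_def doubleton_eq_iff insert_commute)
          with v no_inner show False by auto
        qed
        obtain w where w: "nbrs E s = {v, w}" "w \<noteq> v"
          using cN(1) vN by (metis card_2_iff doubleton_eq_iff insertE singletonD)
        obtain M'' where M'': "outerplanar_map M''" "verts M'' = V - {s} - {v}"
            "edges M'' = suppress (suppress E s) v"
          using suppress_outerplanar[OF M'(1), of v] v unfolding M' by blast
        have "v \<noteq> s" "w \<noteq> s" "w \<in> V" "w \<noteq> t" using N w tN v by auto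
        have card'': "card (V - {s} - {v}) = n - 2" using v card' finV by simp
        have "?f w \<le> card (bipolar (V - {s} - {v}) (suppress (suppress E s) v) w t)"
          using card_bipolar_suppress_inner[OF G' v(1) w(2)[symmetric] v(2,3)]
            finite_bipolar outerplanar_graph[OF M''(1)] M''(2,3) by metis
        also have "\<dots> \<le> fib (n - 2 - 1)"
          using less.hyps[of M'' w t] M'' stV v w \<open>w \<noteq> s\<close> \<open>w \<in> V\<close> \<open>w \<noteq> t\<close> card'' n3
          by (simp add: V_def[symmetric] n_def[symmetric])
        finally have "?f w \<le> fib (n - 3)" by (simp add: numeral_3_eq_3 numeral_2_eq_2)
        moreover have "?f v \<le> fib (n - 2)" using f_le[OF vN] .
        moreover have "(\<Sum>a\<in>nbrs E s. ?f a) = ?f v + ?f w" using w by simp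
        moreover have "fib (n - 1) = fib (n - 2) + fib (n - 3)"
          using fib_plus_2[of "n - 3"] n4 by (simp add: numeral_eq_Suc Suc_diff_Suc)
        ultimately show ?thesis using sum by linarith
      qed
    qed
  qed
qed


section \<open>The zigzag strip attains the bound\<close>

text \<open>The vertices alternate between the lines \<open>Im z = 1\<close> and \<open>Im z = - 1\<close> and are joined by straight
  segments when their indices differ by at most 2. A difference of 1 gives a rung, which crosses the strip between
  the lines, and a difference of 2 gives a part of a rail on one of the lines.\<close>

definition strip_pt :: "nat \<Rightarrow> complex" where
  "strip_pt k = Complex (real k) (if even k then 1 else - 1)"

lemma strip_pt_eq_iff [simp]: "strip_pt i = strip_pt j \<longleftrightarrow> i = j"
  by (auto simp: strip_pt_def)

definition strip_edge :: "nat \<Rightarrow> nat \<Rightarrow> complex set" where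
  "strip_edge i d = {strip_pt i, strip_pt (i + d)}"

text \<open>The drawing of an edge depends on the set of its endpoints only, so the curve first recovers their
  indices from that set.\<close>

definition strip :: "nat \<Rightarrow> plane_map" where
  "strip n = \<lparr>verts = strip_pt ` {..<n},
     edges = {strip_edge i d | i d. d \<in> {1, 2} \<and> i + d < n},
     curve = \<lambda>e. linepath (strip_pt (LEAST k. strip_pt k \<in> e))
               (strip_pt (GREATEST k. strip_pt k \<in> e))\<rparr>"

lemma curve_strip: "curve (strip n) (strip_edge i d) = linepath (strip_pt i) (strip_pt (i + d))"
proof -
  have "(LEAST k. strip_pt k \<in> strip_edge i d) = i"
    by (rule Least_equality) (auto simp: strip_edge_def)
  moreover have "(GREATEST k. strip_pt k \<in> strip_edge i d) = i + d"
    by (rule Greatest_equality) (auto simp: strip_edge_def)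
  ultimately show ?thesis by (simp add: strip_def)
qed

lemma strip_sel [simp]:
  "verts (strip n) = strip_pt ` {..<n}"
  "edges (strip n) = {strip_edge i d | i d. d \<in> {1, 2} \<and> i + d < n}"
  by (simp_all add: strip_def)

lemma on_rung:
  assumes "z \<in> closed_segment (strip_pt i) (strip_pt (i + 1))"
  shows "real i \<le> Re z" "Re z \<le> real i + 1"
    and "Im z = (if even i then 1 else - 1) * (1 - 2 * (Re z - real i))"
proof -
  obtain u where u: "0 \<le> u" "u \<le> 1" "z = (1 - u) *\<^sub>R strip_pt i + u *\<^sub>R strip_pt (i + 1)"
    using assms by (auto simp: closed_segment_def)
  have "Re z = real i + u" by (subst u(3)) (simp add: strip_pt_def algebra_simps)
  with u show "real i \<le> Re z" "Re z \<le> real i + 1"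
    "Im z = (if even i then 1 else - 1) * (1 - 2 * (Re z - real i))"
    by (simp_all add: strip_pt_def)
qed

lemma on_rail:
  assumes "z \<in> closed_segment (strip_pt i) (strip_pt (i + 2))"
  shows "real i \<le> Re z" "Re z \<le> real i + 2" "Im z = (if even i then 1 else - 1)"
proof -
  obtain u where u: "0 \<le> u" "u \<le> 1" "z = (1 - u) *\<^sub>R strip_pt i + u *\<^sub>R strip_pt (i + 2)"
    using assms by (auto simp: closed_segment_def)
  have "Re z = real i + 2 * u" by (subst u(3)) (simp add: strip_pt_def algebra_simps)
  moreover have "Im z = (if even i then 1 else - 1)" by (subst u(3)) (simp add: strip_pt_def)
  ultimately show "real i \<le> Re z" "Re z \<le> real i + 2" "Im z = (if even i then 1 else - 1)"
    using u by simp_all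
qed

lemma strip_ptI: "Re z = real k \<Longrightarrow> Im z = (if even k then 1 else - 1) \<Longrightarrow> z = strip_pt k"
  by (simp add: strip_pt_def complex_eq_iff)

lemma strip_pt_on_segment:
  assumes "strip_pt k \<in> closed_segment (strip_pt i) (strip_pt (i + d))" "d \<in> {1, 2}"
  shows "k = i \<or> k = i + d"
proof (cases "d = 1")
  case True
  then have "real i \<le> real k" "real k \<le> real i + 1"
    using on_rung[of "strip_pt k" i] assms(1) by (auto simp: strip_pt_def)
  then have "i \<le> k" "k \<le> i + 1" by linarith+
  with True show ?thesis by linarith
next
  case False
  then have "d = 2" using assms(2) by simp
  then have "real i \<le> real k" "real k \<le> real i + 2" "even i = even k"
    using on_rail[of "strip_pt k" i] assms(1) by (auto simp: strip_pt_def split: if_splits)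
  then have "i \<le> k" "k \<le> i + 2" "k \<noteq> i + 1" by auto
  with \<open>d = 2\<close> show ?thesis by linarith
qed

text \<open>Two segments of the same kind can share only the abscissa at which one ends and the other
  begins, and a rung reaches the lines of the rails only at its ends.\<close>

lemma strip_segments_meet:
  assumes z: "z \<in> closed_segment (strip_pt i) (strip_pt (i + d))" "z \<in> closed_segment (strip_pt j) (strip_pt (j + d'))"
    and d: "d \<in> {1, 2}" "d' \<in> {1, 2}" and ne: "(i, d) \<noteq> (j, d')"
  shows "\<exists>k. z = strip_pt k"
proof -
  have rungs: "\<exists>k. z = strip_pt k"
    if "z \<in> closed_segment (strip_pt i) (strip_pt (i + 1))" "z \<in> closed_segment (strip_pt j) (strip_pt (j + 1))" "i < j" for i j
  proof -
    note h = on_rung[OF that(1)] and h' = on_rung[OF that(2)]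
    have "real j \<ge> real i + 1" using that(3) by linarith
    then have "Re z = real j" using h h' by linarith
    then show ?thesis using h'(3) by (intro exI[of _ j] strip_ptI) auto
  qed
  have rails: "\<exists>k. z = strip_pt k"
    if "z \<in> closed_segment (strip_pt i) (strip_pt (i + 2))" "z \<in> closed_segment (strip_pt j) (strip_pt (j + 2))" "i < j" for i j
  proof -
    note h = on_rail[OF that(1)] and h' = on_rail[OF that(2)]
    have "even i = even j" using h(3) h'(3) by (auto split: if_splits)
    then have "j \<noteq> i + 1" by auto
    then have "real j \<ge> real i + 2" using that(3) by linarith
    then have "Re z = real j" using h h' by linarith
    then show ?thesis using h'(3) by (intro exI[of _ j] strip_ptI) auto
  qed
  have rung_rail: "\<exists>k. z = strip_pt k"
    if "z \<in> closed_segment (strip_pt i) (strip_pt (i + 1))" "z \<in> closed_segment (strip_pt j) (strip_pt (j + 2))" for i j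
  proof -
    note h = on_rung[OF that(1)] and h' = on_rail[OF that(2)]
    show ?thesis
    proof (cases "even i = even j")
      case True
      then have "Re z = real i" using h(3) h'(3) by (auto split: if_splits)
      then show ?thesis using h(3) by (intro exI[of _ i] strip_ptI) auto
    next
      case False
      then have "Re z = real (i + 1)" using h(3) h'(3) by (auto split: if_splits)
      then show ?thesis using h(3) by (intro exI[of _ "i + 1"] strip_ptI) auto
    qed
  qed
  consider "d = 1" "d' = 1" "i < j" | "d = 1" "d' = 1" "j < i" | "d = 2" "d' = 2" "i < j" | "d = 2" "d' = 2" "j < i"
    | "d = 1" "d' = 2" | "d = 2" "d' = 1"
    using d ne by (auto simp: nat_neq_iff)
  then show ?thesis using z rungs[of i j] rungs[of j i] rails[of i j] rails[of j i] rung_rail[of i j] rung_rail[of j i]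
    by cases auto
qed

lemma planar_map_strip: "planar_map (strip n)"
proof -
  have endp: "path_image (curve (strip n) (strip_edge i d)) = closed_segment (strip_pt i) (strip_pt (i + d))" for i d
    by (simp add: curve_strip)
  have on: "path_image (curve (strip n) (strip_edge i d)) \<inter> range strip_pt = strip_edge i d" if "d \<in> {1, 2}" for i d
    using strip_pt_on_segment[OF _ that, of _ i] unfolding endp by (auto simp: strip_edge_def)
  have meet: "path_image (curve (strip n) (strip_edge i d)) \<inter> path_image (curve (strip n) (strip_edge j d'))
      = strip_edge i d \<inter> strip_edge j d'"
    if "d \<in> {1, 2}" "d' \<in> {1, 2}" "strip_edge i d \<noteq> strip_edge j d'" for i d j d'
  proof -
    have ne: "(i, d) \<noteq> (j, d')" using that(3) by auto
    have "path_image (curve (strip n) (strip_edge i d)) \<inter> path_image (curve (strip n) (strip_edge j d')) \<subseteq> range strip_pt"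
      using strip_segments_meet[OF _ _ that(1,2) ne] unfolding endp by blast
    then show ?thesis using on[OF that(1), of i] on[OF that(2), of j] by blast
  qed
  have edge: "strip_edge i d \<subseteq> strip_pt ` {..<n} \<and> card (strip_edge i d) = 2 \<and> arc (curve (strip n) (strip_edge i d)) \<and>
      {pathstart (curve (strip n) (strip_edge i d)), pathfinish (curve (strip n) (strip_edge i d))} = strip_edge i d \<and>
      path_image (curve (strip n) (strip_edge i d)) \<inter> strip_pt ` {..<n} = strip_edge i d"
    if "d \<in> {1, 2}" "i + d < n" for i d
  proof -
    have sub: "strip_edge i d \<subseteq> strip_pt ` {..<n}" using that by (auto simp: strip_edge_def)
    moreover have "path_image (curve (strip n) (strip_edge i d)) \<inter> strip_pt ` {..<n} = strip_edge i d"
      using on[OF that(1), of i] sub by blast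
    moreover have "0 < d" using that by auto
    moreover have "card (strip_edge i d) = 2" using \<open>0 < d\<close> by (simp add: strip_edge_def)
    moreover have "arc (curve (strip n) (strip_edge i d))"
      "{pathstart (curve (strip n) (strip_edge i d)), pathfinish (curve (strip n) (strip_edge i d))} = strip_edge i d"
      using \<open>0 < d\<close> by (simp_all add: curve_strip) (simp add: strip_edge_def)
    ultimately show ?thesis by blast
  qed
  show ?thesis
    unfolding planar_map_def strip_sel
  proof (intro conjI ballI impI)
    show "finite (strip_pt ` {..<n})" by simp
  next
    fix e assume "e \<in> {strip_edge i d | i d. d \<in> {1, 2} \<and> i + d < n}"
    then obtain i d where "e = strip_edge i d" "d \<in> {1, 2}" "i + d < n" by blast
    with edge show "e \<subseteq> strip_pt ` {..<n}" "card e = 2" "arc (curve (strip n) e)"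
      "{pathstart (curve (strip n) e), pathfinish (curve (strip n) e)} = e"
      "path_image (curve (strip n) e) \<inter> strip_pt ` {..<n} = e" by simp_all
  next
    fix e f assume "e \<in> {strip_edge i d | i d. d \<in> {1, 2} \<and> i + d < n}"
      "f \<in> {strip_edge i d | i d. d \<in> {1, 2} \<and> i + d < n}" "e \<noteq> f"
    then obtain i d j d' where "e = strip_edge i d" "d \<in> {1, 2}" "f = strip_edge j d'" "d' \<in> {1, 2}" by blast
    with meet \<open>e \<noteq> f\<close> show "path_image (curve (strip n) e) \<inter> path_image (curve (strip n) f) = e \<inter> f"
      by metis
  qed
qed

text \<open>The drawing lies in a closed horizontal strip with all vertices on its boundary lines.\<close>

lemma outerplanar_map_strip: "outerplanar_map (strip n)"
  unfolding outerplanar_map_def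
proof (intro conjI ballI planar_map_strip)
  define S where "S = {z::complex. Im z \<le> 1} \<inter> {z. Im z \<ge> - 1}"
  have convex: "convex S"
    unfolding S_def by (intro convex_Int convex_halfspace_Im_le convex_halfspace_Im_ge)
  have pt: "strip_pt k \<in> S" for k by (simp add: S_def strip_pt_def)
  have draw: "drawing (strip n) \<subseteq> S"
  proof -
    have "path_image (curve (strip n) e) \<subseteq> S" if "e \<in> edges (strip n)" for e
    proof -
      obtain i d where "e = strip_edge i d" using \<open>e \<in> edges (strip n)\<close> by auto
      then show ?thesis using closed_segment_subset[OF pt pt convex] by (simp add: curve_strip)
    qed
    then show ?thesis unfolding drawing_def using pt by auto
  qed
  have "- S \<subseteq> outside (drawing (strip n))"
    using outside_mono[OF draw] outside_convex[OF convex] by simp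
  fix v assume v: "v \<in> verts (strip n)"
  then obtain k where k: "v = strip_pt k" by auto
  have "v \<in> closure (outside (drawing (strip n)))"
    unfolding closure_approachable
  proof (intro allI impI)
    fix e :: real assume "e > 0"
    define w where "w = v + Complex 0 (Im v * (e / 2))"
    have "w \<notin> S" using \<open>e > 0\<close> by (auto simp: w_def k strip_pt_def S_def)
    with \<open>- S \<subseteq> outside (drawing (strip n))\<close> have "w \<in> outside (drawing (strip n))" by blast
    moreover have "dist w v < e"
      using \<open>e > 0\<close> by (simp add: w_def dist_norm k strip_pt_def cmod_def)
    ultimately show "\<exists>w\<in>outside (drawing (strip n)). dist w v < e" by blast
  qed
  moreover have "v \<notin> outside (drawing (strip n))"
    using v outside_no_overlap[of "drawing (strip n)"] unfolding drawing_def by blast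
  ultimately have "v \<in> frontier (outside (drawing (strip n)))"
    using interior_subset by (auto simp: frontier_def)
  with v show "on_outer_face (strip n) v" by (simp add: on_outer_face_def outer_face_def)
qed

definition sparse_sets :: "nat \<Rightarrow> nat set set" where
  "sparse_sets k = {R. R \<subseteq> {1..<k} \<and> (\<forall>i\<in>R. Suc i \<notin> R)}"

lemma finite_sparse_sets: "finite (sparse_sets k)"
  by (rule finite_subset[of _ "Pow {1..<k}"]) (auto simp: sparse_sets_def)

text \<open>Removing the largest admissible element \<open>k + 1\<close> from a set that contains it leaves a set without \<open>k\<close>.\<close>

lemma card_sparse_sets: "card (sparse_sets k) = fib (k + 1)"
proof (induction k rule: fib.induct)
  case 1
  have "sparse_sets 0 = {{}}" by (auto simp: sparse_sets_def)
  then show ?case by simp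
next
  case 2
  have "sparse_sets (Suc 0) = {{}}" by (auto simp: sparse_sets_def)
  then show ?case by simp
next
  case (3 k)
  have split: "sparse_sets (Suc (Suc k)) - sparse_sets (Suc k) = insert (Suc k) ` (sparse_sets k)" if "k > 0"
  proof (intro equalityI subsetI)
    fix R assume R: "R \<in> sparse_sets (Suc (Suc k)) - sparse_sets (Suc k)"
    then have "Suc k \<in> R" by (auto simp: sparse_sets_def less_Suc_eq)
    moreover have "R - {Suc k} \<in> sparse_sets k"
      using R calculation by (auto simp: sparse_sets_def less_Suc_eq)
    ultimately show "R \<in> insert (Suc k) ` (sparse_sets k)"
      by (intro image_eqI[of _ _ "R - {Suc k}"]) auto
  next
    fix R assume "R \<in> insert (Suc k) ` (sparse_sets k)"
    then obtain R' where R': "R = insert (Suc k) R'" "R' \<in> sparse_sets k" by blast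
    then have "i < k" if "i \<in> R'" for i using that by (auto simp: sparse_sets_def)
    with R' show "R \<in> sparse_sets (Suc (Suc k)) - sparse_sets (Suc k)"
      by (fastforce simp: sparse_sets_def)
  qed
  show ?case
  proof (cases "k = 0")
    case True
    have "sparse_sets 2 = {{}, {1}}"
      by (auto simp: sparse_sets_def numeral_2_eq_2 atLeastLessThanSuc subset_singleton_iff)
    with True show ?thesis by (simp add: numeral_2_eq_2)
  next
    case False
    have inj: "inj_on (insert (Suc k)) (sparse_sets k)"
    proof (rule inj_onI)
      fix R R' assume "R \<in> sparse_sets k" "R' \<in> sparse_sets k" "insert (Suc k) R = insert (Suc k) R'"
      moreover from this have "Suc k \<notin> R" "Suc k \<notin> R'" by (auto simp: sparse_sets_def)
      ultimately show "R = R'" by (metis insert_ident)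
    qed
    have "sparse_sets (Suc k) \<subseteq> sparse_sets (Suc (Suc k))"
      by (auto simp: sparse_sets_def)
    then have "card (sparse_sets (Suc (Suc k))) = card (sparse_sets (Suc k)) +
        card (sparse_sets (Suc (Suc k)) - sparse_sets (Suc k))"
      using card_mono[OF finite_sparse_sets] finite_sparse_sets by (simp add: card_Diff_subset)
    also have "\<dots> = fib (Suc k + 1) + fib (k + 1)"
      using 3 split False inj by (simp add: card_image)
    finally show ?thesis by simp
  qed
qed

text \<open>The orientation follows increasing indices except on the rungs \<open>i\<close> to \<open>i + 1\<close> with \<open>i \<in> R\<close>, which are
  reversed. Two consecutive reversed rungs would close a directed triangle with the rail between
  them. The first and the last rung, with \<open>i = 0\<close> and \<open>i = n - 2\<close>, must not be reversed if \<open>0\<close> is to be the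
  source and \<open>n - 1\<close> the sink, hence the index set \<open>{1..<n - 2}\<close>.\<close>

definition strip_orientation :: "nat \<Rightarrow> nat set \<Rightarrow> (complex \<times> complex) set" where
  "strip_orientation n R = {(strip_pt i, strip_pt j) | i j. i < n \<and> j < n \<and>
     (j = i + 2 \<or> j = i + 1 \<and> i \<notin> R \<or> i = j + 1 \<and> j \<in> R)}"

lemma strip_orientation_iff:
  "(strip_pt i, strip_pt j) \<in> strip_orientation n R \<longleftrightarrow>
     i < n \<and> j < n \<and> (j = i + 2 \<or> j = i + 1 \<and> i \<notin> R \<or> i = j + 1 \<and> j \<in> R)"
  by (auto simp: strip_orientation_def)

text \<open>Exchanging \<open>i\<close> and \<open>i + 1\<close> for every reversed rung \<open>i\<close> gives a topological order: no two
  reversed rungs are consecutive, so the exchanges do not interfere.\<close>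

lemma strip_orientation_acyclic:
  assumes R: "R \<in> sparse_sets (n - 2)"
  shows "acyclic (strip_orientation n R)"
proof -
  define rank where "rank i = (if i \<in> R then i + 1 else if i > 0 \<and> i - 1 \<in> R then i - 1 else i)" for i
  have "rank i < rank j" if "(strip_pt i, strip_pt j) \<in> strip_orientation n R" for i j
  proof -
    have R': "\<And>i. i \<in> R \<Longrightarrow> Suc i \<notin> R" using R by (auto simp: sparse_sets_def)
    from that consider "j = i + 2" | "j = i + 1" "i \<notin> R" | "i = j + 1" "j \<in> R"
      by (auto simp: strip_orientation_iff)
    then show ?thesis
    proof cases
      case 1
      have "i + 1 \<le> rank j" using 1 by (simp add: rank_def)
      moreover have "rank i \<le> i" if "i \<notin> R" using that by (simp add: rank_def)
      moreover have "rank i = i + 1 \<and> i + 2 \<le> rank j" if "i \<in> R" using that R'[OF that] 1 by (simp add: rank_def)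
      ultimately show ?thesis by fastforce
    next
      case 2
      have "rank i \<le> i" unfolding rank_def using 2(2) by simp
      moreover have "i + 1 \<le> rank j" unfolding rank_def 2(1) using 2(2) by simp
      ultimately show ?thesis by linarith
    next
      case 3
      have "rank j = j + 1" unfolding rank_def using 3(2) by simp
      moreover have "rank i = j" unfolding rank_def 3(1) using 3(2) R'[OF 3(2)] by simp
      ultimately show ?thesis by simp
    qed
  qed
  note rank = this
  have "strip_orientation n R \<subseteq> inv_image less_than (\<lambda>z. rank (nat \<lfloor>Re z\<rfloor>))"
  proof
    fix p assume p: "p \<in> strip_orientation n R"
    then obtain i j where ij: "p = (strip_pt i, strip_pt j)" unfolding strip_orientation_def by blast
    with p rank have "rank i < rank j" by blast
    then show "p \<in> inv_image less_than (\<lambda>z. rank (nat \<lfloor>Re z\<rfloor>))"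
      unfolding ij by (simp add: strip_pt_def)
  qed
  then show ?thesis
    by (meson acyclic_subset wf_acyclic wf_inv_image wf_less_than)
qed

lemma strip_orientation_bipolar:
  assumes n: "2 \<le> n" and R: "R \<in> sparse_sets (n - 2)"
  shows "strip_orientation n R \<in> bipolar (verts (strip n)) (edges (strip n)) (strip_pt 0) (strip_pt (n - 1))"
proof -
  have R': "1 \<le> i \<and> i + 2 < n" if "i \<in> R" for i
  proof -
    have "i \<in> {1..<n - 2}" using R that by (auto simp: sparse_sets_def)
    then show ?thesis by auto
  qed
  have edge: "{x, y} \<in> edges (strip n) \<longleftrightarrow>
      (\<exists>i d. d \<in> {1, 2} \<and> i + d < n \<and> ((x, y) = (strip_pt i, strip_pt (i + d)) \<or> (y, x) = (strip_pt i, strip_pt (i + d))))" for x y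
    by (auto simp: strip_edge_def doubleton_eq_iff)
  show ?thesis
  proof (rule bipolarI)
    show "{x, y} \<in> edges (strip n)" if "(x, y) \<in> strip_orientation n R" for x y
    proof -
      obtain i j where ij: "x = strip_pt i" "y = strip_pt j" "i < n" "j < n" "j = i + 2 \<or> j = i + 1 \<or> i = j + 1"
        using \<open>(x, y) \<in> strip_orientation n R\<close> by (auto simp: strip_orientation_def)
      then show ?thesis unfolding edge by (metis insertCI)
    qed
    show "(x, y) \<in> strip_orientation n R \<or> (y, x) \<in> strip_orientation n R" if "{x, y} \<in> edges (strip n)" for x y
      using that unfolding edge by (auto simp: strip_orientation_iff)
    show "acyclic (strip_orientation n R)" by (rule strip_orientation_acyclic[OF R])
    show "strip_pt 0 \<in> verts (strip n)" "strip_pt (n - 1) \<in> verts (strip n)" using n by auto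
    show "(u, strip_pt 0) \<notin> strip_orientation n R" for u
      using R'[of 0] by (auto simp: strip_orientation_def)
    show "(strip_pt (n - 1), w) \<notin> strip_orientation n R" for w
      using n by (auto simp: strip_orientation_def dest: R')
    show "\<exists>u. (u, v) \<in> strip_orientation n R" if "v \<in> verts (strip n)" "v \<noteq> strip_pt 0" for v
    proof -
      obtain k where k: "v = strip_pt k" "k < n" "0 < k" using \<open>v \<in> verts (strip n)\<close> \<open>v \<noteq> strip_pt 0\<close> by auto
      show ?thesis
      proof (cases "k = 1")
        case True
        then show ?thesis using k R'[of 0] by (intro exI[of _ "strip_pt 0"]) (auto simp: strip_orientation_iff)
      next
        case False
        then show ?thesis using k by (intro exI[of _ "strip_pt (k - 2)"]) (auto simp: strip_orientation_iff)
      qed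
    qed
    show "\<exists>w. (v, w) \<in> strip_orientation n R" if "v \<in> verts (strip n)" "v \<noteq> strip_pt (n - 1)" for v
    proof -
      obtain k where k: "v = strip_pt k" "k + 1 < n"
        using \<open>v \<in> verts (strip n)\<close> \<open>v \<noteq> strip_pt (n - 1)\<close> by (force simp: less_diff_conv)
      show ?thesis
      proof (cases "k + 2 = n")
        case True
        then show ?thesis using k R'[of k] by (intro exI[of _ "strip_pt (k + 1)"]) (auto simp: strip_orientation_iff)
      next
        case False
        then show ?thesis using k by (intro exI[of _ "strip_pt (k + 2)"]) (auto simp: strip_orientation_iff)
      qed
    qed
  qed
qed

lemma fib_le_card_bipolar_strip:
  assumes n: "2 \<le> n"
  shows "fib (n - 1) \<le> card (bipolar (verts (strip n)) (edges (strip n)) (strip_pt 0) (strip_pt (n - 1)))"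
proof -
  have "inj_on (strip_orientation n) (sparse_sets (n - 2))"
  proof (rule inj_onI)
    fix R R' assume R: "R \<in> sparse_sets (n - 2)" "R' \<in> sparse_sets (n - 2)"
      and eq: "strip_orientation n R = strip_orientation n R'"
    have "i \<in> Q \<longleftrightarrow> i + 1 < n \<and> (strip_pt (i + 1), strip_pt i) \<in> strip_orientation n Q"
      if "Q \<in> sparse_sets (n - 2)" for i Q
    proof -
      have "i < n - 2" if "i \<in> Q" using that \<open>Q \<in> sparse_sets (n - 2)\<close> by (auto simp: sparse_sets_def)
      then show ?thesis by (auto simp: strip_orientation_iff)
    qed
    with R eq show "R = R'" by (simp add: set_eq_iff)
  qed
  moreover have "strip_orientation n ` sparse_sets (n - 2) \<subseteq>
      bipolar (verts (strip n)) (edges (strip n)) (strip_pt 0) (strip_pt (n - 1))"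
    using strip_orientation_bipolar[OF n] by blast
  ultimately have "card (sparse_sets (n - 2)) \<le>
      card (bipolar (verts (strip n)) (edges (strip n)) (strip_pt 0) (strip_pt (n - 1)))"
    using finite_bipolar[OF outerplanar_graph[OF outerplanar_map_strip]] by (intro card_inj_on_le)
  moreover have "n - 2 + 1 = n - 1" using n by simp
  ultimately show ?thesis by (metis card_sparse_sets)
qed

section \<open>The growth rate\<close>

text \<open>The powers of the golden ratio satisfy the Fibonacci recursion, so the bounds follow from their first
  two cases.\<close>

lemma golden_ratio_power_bounds:
  defines "\<phi> \<equiv> (1 + sqrt 5) / 2"
  shows "real (fib n) \<le> \<phi> ^ n" and "\<phi> ^ Suc n \<le> \<phi>\<^sup>2 * real (fib (Suc n))"
proof -
  have sq: "\<phi>\<^sup>2 = \<phi> + 1" by (simp add: \<phi>_def power2_eq_square field_simps)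
  have ge1: "1 \<le> \<phi>" by (simp add: \<phi>_def)
  have rec: "\<phi> ^ (k + 2) = \<phi> ^ Suc k + \<phi> ^ k" for k
  proof -
    have "\<phi> ^ (k + 2) = \<phi> ^ k * \<phi>\<^sup>2" by (simp only: power_add)
    then show ?thesis unfolding sq by (simp add: algebra_simps)
  qed
  show "real (fib n) \<le> \<phi> ^ n"
  proof (induction n rule: fib.induct)
    case (3 n)
    then show ?case using rec[of n] by simp
  qed (use ge1 in auto)
  show "\<phi> ^ Suc n \<le> \<phi>\<^sup>2 * real (fib (Suc n))"
  proof (induction n rule: fib.induct)
    case 1
    then show ?case using ge1 sq by simp
  next
    case 2
    then show ?case by (simp add: power2_eq_square)
  next
    case (3 n)
    then show ?case using rec[of "Suc n"] by (simp add: algebra_simps)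
  qed
qed

lemma root_fib_tendsto: "(\<lambda>n. root (n - 1) (real (fib (n - 1)))) \<longlonglongrightarrow> (1 + sqrt 5) / 2"
proof -
  define \<phi> :: real where "\<phi> = (1 + sqrt 5) / 2"
  note bounds = golden_ratio_power_bounds[folded \<phi>_def]
  have pos: "\<phi> > 0" by (simp add: \<phi>_def add_pos_nonneg)
  have "(\<lambda>n. root n (real (fib n))) \<longlonglongrightarrow> \<phi>"
  proof (rule tendsto_sandwich)
    show "(\<lambda>n. \<phi> / root n (\<phi>\<^sup>2)) \<longlonglongrightarrow> \<phi>"
      using tendsto_divide[OF tendsto_const LIMSEQ_root_const, of "\<phi>\<^sup>2" \<phi>] pos by simp
    show "(\<lambda>n. \<phi>) \<longlonglongrightarrow> \<phi>" by simp
    show "\<forall>\<^sub>F n in sequentially. root n (real (fib n)) \<le> \<phi>"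
      using eventually_gt_at_top[of 0]
    proof eventually_elim
      case (elim n)
      then have "root n (real (fib n)) \<le> root n (\<phi> ^ n)" using bounds(1) by simp
      with elim pos show ?case by (simp add: real_root_power_cancel)
    qed
    show "\<forall>\<^sub>F n in sequentially. \<phi> / root n (\<phi>\<^sup>2) \<le> root n (real (fib n))"
      using eventually_gt_at_top[of 0]
    proof eventually_elim
      case (elim n)
      then obtain m where m: "n = Suc m" by (cases n) auto
      have "\<phi> = root n (\<phi> ^ n)" using elim pos by (simp add: real_root_power_cancel)
      also have "\<dots> \<le> root n (\<phi>\<^sup>2 * real (fib n))" using elim bounds(2)[of m] unfolding m by (simp only: real_root_le_iff zero_less_Suc)
      also have "\<dots> = root n (\<phi>\<^sup>2) * root n (real (fib n))" by (rule real_root_mult)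
      finally show ?case using elim pos by (simp add: divide_le_eq mult.commute)
    qed
  qed
  then have "(\<lambda>n. root (Suc n - 1) (real (fib (Suc n - 1)))) \<longlonglongrightarrow> (1 + sqrt 5) / 2"
    by (simp add: \<phi>_def)
  then show ?thesis by (rule LIMSEQ_imp_Suc)
qed

section \<open>The maximum number of bipolar orientations\<close>

theorem proposition9:
  shows "(\<forall>n\<ge>2. finite (bipolar_counts n) \<and> bipolar_counts n \<noteq> {} \<and>
            Max (bipolar_counts n) = fib (n - 1)) \<and>
         (\<lambda>n. root (n - 1) (real (fib (n - 1)))) \<longlonglongrightarrow> (1 + sqrt 5) / 2 \<and>
         \<bar>(1 + sqrt 5) / 2 - 1.618\<bar> < (0.0005 :: real)"
proof (intro conjI allI impI)
  fix n :: nat assume n: "2 \<le> n"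
  have bound: "c \<le> fib (n - 1)" if "c \<in> bipolar_counts n" for c
  proof -
    obtain M s t where "c = card (bipolar_orientations M s t)" "outerplanar_map M" "card (verts M) = n"
      "s \<in> verts M" "t \<in> verts M" "s \<noteq> t"
      using \<open>c \<in> bipolar_counts n\<close>
      unfolding bipolar_counts_def outerplanar_maps_def on_outer_face_def by blast
    then show ?thesis
      using card_bipolar_le_fib[of M s t] by (simp add: bipolar_orientations_eq)
  qed
  then show fin: "finite (bipolar_counts n)"
    by (meson atMost_iff finite_atMost finite_subset subsetI)
  define c where "c = card (bipolar_orientations (strip n) (strip_pt 0) (strip_pt (n - 1)))"
  have on: "on_outer_face (strip n) v" if "v \<in> verts (strip n)" for v
    using outerplanar_map_strip[of n] that by (auto simp: outerplanar_map_def)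
  have "card (verts (strip n)) = n"
    by (simp add: card_image inj_on_def)
  then have "strip n \<in> outerplanar_maps n"
    using outerplanar_map_strip by (simp add: outerplanar_maps_def)
  moreover have "on_outer_face (strip n) (strip_pt 0)" "on_outer_face (strip n) (strip_pt (n - 1))"
    "strip_pt 0 \<noteq> strip_pt (n - 1)"
    using n by (auto intro!: on)
  ultimately have c: "c \<in> bipolar_counts n"
    unfolding bipolar_counts_def c_def by blast
  then show "bipolar_counts n \<noteq> {}" by blast
  have "fib (n - 1) \<le> c"
    using fib_le_card_bipolar_strip[OF n] by (simp add: c_def bipolar_orientations_eq)
  with bound[OF c] have "c = fib (n - 1)" by simp
  with c bound fin show "Max (bipolar_counts n) = fib (n - 1)"
    by (intro Max_eqI) auto
next
  show "(\<lambda>n. root (n - 1) (real (fib (n - 1)))) \<longlonglongrightarrow> (1 + sqrt 5) / 2" by (rule root_fib_tendsto)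
  have "2.235 < sqrt 5" by (rule real_less_rsqrt) (simp add: power2_eq_square)
  moreover have "sqrt 5 < 2.237" by (rule real_less_lsqrt) (simp_all add: power2_eq_square)
  ultimately show "\<bar>(1 + sqrt 5) / 2 - 1.618\<bar> < (0.0005 :: real)"
    unfolding abs_less_iff by simp
qed

end
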